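(* Let $n\ge 7$ and let $\mathcal{A}$ be the adjacency matrix of the Johnson graph $\Gamma(n,3,2)$. Set $$X=\gcd\bigl(3(n-3)(2n-9),\ (n-7)(n-3)(2n-9),\ 12,\ 2n(n-7),\ 3(n-7)\bigr).$$ Then $\mathcal{A}$ has a diagonal form whose diagonal entries are exactly the following (with multiplicities added together when the same integer occurs more than once in the list): (1) $3(n-7)$ with multiplicity $\binom{n}{2}-2n+1$; (2) $3(2n-9)(n-7)$ with multiplicity $n-2$; (3) $3$ with multiplicity $\binom{n}{3}-2\binom{n}{2}+n+1$; (4) $3(n-3)(n-7)(2n-9)/X$ with multiplicity $1$, and $X$ with multiplicity $1$; (5) $1$ with multiplicity $\binom{n}{2}-2$.
   Context: The graph $\Gamma(n,k,\ell)$ has as vertices the $k$-element subsets of $\{1,\dots,n\}$, two of them adjacent when they intersect in exactly $\ell$ elements. A unimodular matrix is a square integer matrix with an integer inverse. A diagonal form of an integer matrix $M$ is a matrix $D$ of the same dimensions as $M$, with $(i,j)$-entry $0$ unless $i=j$, such that $EMF=D$ for some unimodular matrices $E,F$. *)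

theory Defs
  imports "Jordan_Normal_Form.Matrix"
begin

definition johnson_verts :: "nat \<Rightarrow> nat \<Rightarrow> nat set set" where
  "johnson_verts n k = {S. S \<subseteq> {1..n} \<and> card S = k}"

(* Restricting to distinct S, T makes the graph loopless also when l = k. *)
definition johnson_adj :: "nat \<Rightarrow> nat \<Rightarrow> nat \<Rightarrow> nat set \<Rightarrow> nat set \<Rightarrow> bool" where
  "johnson_adj n k l S T \<longleftrightarrow>
     S \<in> johnson_verts n k \<and> T \<in> johnson_verts n k \<and> S \<noteq> T \<and> card (S \<inter> T) = l"

(* The adjacency matrix with respect to the ordering of the vertices given by the list vs,
   which is meant to enumerate the vertex set without repetition. *)
definition adjacency_mat :: "('v \<Rightarrow> 'v \<Rightarrow> bool) \<Rightarrow> 'v list \<Rightarrow> int mat" where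
  "adjacency_mat adj vs =
     mat (length vs) (length vs) (\<lambda>(i, j). if adj (vs ! i) (vs ! j) then 1 else 0)"

(* invertible_mat over the semiring int requires the two-sided inverse to be integral. *)
definition unimodular :: "int mat \<Rightarrow> bool" where
  "unimodular U \<longleftrightarrow> invertible_mat U"

definition diagonal_form :: "int mat \<Rightarrow> int mat \<Rightarrow> bool" where
  "diagonal_form M D \<longleftrightarrow>
     D \<in> carrier_mat (dim_row M) (dim_col M) \<and> diagonal_mat D \<and>
     (\<exists>E F. E \<in> carrier_mat (dim_row M) (dim_row M) \<and> unimodular E \<and>
            F \<in> carrier_mat (dim_col M) (dim_col M) \<and> unimodular F \<and>
            E * M * F = D)"

end

theory Submission
  imports Defs "Jordan_Normal_Form.Determinant" "HOL-Library.Function_Algebras"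
begin

text \<open>
  For a subset T of {1..n} with at most three elements let X T be the sum of all triples that contain
  T, as a vector indexed by triples. Counting neighbours shows that the adjacency operator A acts on
  these vectors in a triangular way: A (X T) is \<lambda>_i * X T plus (4 - i) times the sum of the
  vectors X (T - {a}), where i = card T and \<lambda>_0 = 3(n - 3), \<lambda>_1 = 2n - 9, \<lambda>_2 = n - 7,
  \<lambda>_3 = -3. To diagonalise A over the integers it is enough to find two bases (p_j) and (q_j) of
  the lattice of all integer vectors with A p_j = d_j * q_j, and it is enough to do so on small blocks.

  Let N be the span of the X T with card T at most 2. It has a basis consisting of vectors y, v_a, u_a
  and z, X {1}, X {} with A y = \<lambda>_2 y, A v_a = \<lambda>_2 v_a + 2 u_a, A u_a = \<lambda>_1 u_a,
  A z = \<lambda>_2 z + 4 X {1}, A (X {1}) = \<lambda>_1 X {1} + 3 X {}, A (X {}) = \<lambda>_0 X {}. The last three span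
  an invariant sublattice of rank 3. A suitable set of triples spans a complement R of N
  (lemma \<open>star_in_low_free_span\<close>), and A + 3 maps R into N, because it sends a triple to the sum of
  the X p for its three pairs p.

  If r in R satisfies (A + 3) r = b + 3 \<nu> with \<nu> in N, then A r = b - 3 (r - \<nu>). Replacing r by r - \<nu>
  on the target side is harmless, as both bases span N, so only A + 3 modulo 3 N matters on R.
  Modulo 3 N, and after a correction of R by elements of N, the image of A + 3 is exactly the span of the vectors y and
  v_a (lemmas \<open>target_basis_covered\<close> and \<open>gram_correction\<close>). A Steinitz exchange modulo 3
  (lemma \<open>exchange_mod_3\<close>) then turns the basis of R into one where some w goes to y, some t goes
  to v_a, and all other elements o go to 0. Hence the lattice splits into blocks:
  \<^item> {w, y}: contributes 1 and 3 \<lambda>_2;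
  \<^item> {t, v_a, u_a}: contributes 1, 1 and 3 \<lambda>_1 \<lambda>_2, since 2 and the odd number \<lambda>_1 are coprime;
  \<^item> {o}: contributes 3;
  \<^item> {z, X {1}, X {}}: contributes 1, g and \<lambda>_0 \<lambda>_1 \<lambda>_2 / g with g = gcd (\<lambda>_1 \<lambda>_2) 12.

  The number g is the greatest common divisor of the theorem (lemma \<open>gcd_simplified\<close>), and counting the
  blocks of each kind gives the multiplicities. In the formal text X T is \<open>star T\<close>, A + 3 is \<open>gram\<close>,
  N is the span of \<open>low_basis\<close>, 3 N is \<open>low3\<close>, and R is spanned by the stars of \<open>free_triples\<close>.
\<close>

section \<open>Integer spans\<close>

text \<open>Integer vectors are functions into the integers. They form a commutative ring under pointwise
  operations, which lets ring normalisation handle linear identities with numerals; a sublattice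
  is a subspace of the resulting module over the integers.\<close>

interpretation int_span: Modules.module "\<lambda>(c::int) (x::'a::comm_ring_1). of_int c * x"
  by unfold_locales (simp_all add: algebra_simps)

\<comment> \<open>This rule multiplies consecutive scalars, while \<open>of_int_mult\<close> separates them again; together they loop.\<close>
declare int_span.scale_scale [simp del]

abbreviation int_linear :: "('a::comm_ring_1 \<Rightarrow> 'a) \<Rightarrow> bool" where
  "int_linear f \<equiv> Modules.module_hom (\<lambda>c x. of_int c * x) (\<lambda>c x. of_int c * x) f"

lemma span_list_combination:
  assumes "x \<in> int_span.span (set bs)"
  shows "\<exists>c. x = (\<Sum>i<length bs. of_int (c i) * bs ! i)"
  using assms
proof (induction bs arbitrary: x)
  case Nil
  then show ?case by simp
next
  case (Cons b bs)
  then obtain k where "x - of_int k * b \<in> int_span.span (set bs)"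
    by (auto simp: int_span.span_insert)
  from Cons.IH[OF this] obtain c where c: "x - of_int k * b = (\<Sum>i<length bs. of_int (c i) * bs ! i)"
    by blast
  have "x = (\<Sum>i<length (b # bs). of_int (case_nat k c i) * (b # bs) ! i)"
    using c by (simp add: sum.lessThan_Suc_shift algebra_simps del: sum.lessThan_Suc)
  then show ?case by blast
qed

lemma combination_in_span:
  "(\<Sum>i<length bs. of_int (c i) * bs ! i) \<in> int_span.span (set bs)"
  by (intro int_span.span_sum int_span.span_scale int_span.span_base) auto

lemma sum_fun_apply: "(\<Sum>i\<in>I. g i) x = (\<Sum>i\<in>I. (g i :: 'b \<Rightarrow> 'c::comm_monoid_add) x)"
  by (induction I rule: infinite_finite_induct) auto

lemma of_int_fun_apply: "(of_int c :: 'b \<Rightarrow> 'c::ring_1) x = of_int c"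
  by (cases c rule: int_cases2) (simp_all add: of_nat_fun_apply)

lemma combination_append:
  fixes bs cs :: "'a::comm_ring_1 list"
  shows "(\<Sum>i<length bs. of_int (c i) * bs ! i) =
    (\<Sum>i<length (bs @ cs). of_int (if i < length bs then c i else 0) * (bs @ cs) ! i)"
proof -
  have "(\<Sum>i<length (bs @ cs). of_int (if i < length bs then c i else 0) * (bs @ cs) ! i) =
      (\<Sum>i<length bs. of_int (if i < length bs then c i else 0) * (bs @ cs) ! i)"
    by (rule sum.mono_neutral_right) auto
  also have "\<dots> = (\<Sum>i<length bs. of_int (c i) * bs ! i)"
    by (intro sum.cong refl) (simp add: nth_append)
  finally show ?thesis by simp
qed

section \<open>Bases as integer matrices\<close>

text \<open>The vectors in the second list become the columns; the first list fixes the order of the coordinates.\<close>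

definition column_mat :: "'v list \<Rightarrow> ('v \<Rightarrow> int) list \<Rightarrow> int mat" where
  "column_mat vs bs = mat (length vs) (length bs) (\<lambda>(i, j). (bs ! j) (vs ! i))"

text \<open>The determinants of B and C are mutually inverse integers, so the adjugate of B, multiplied by the
  determinant of C, is an integral left inverse of B, and it must agree with the right inverse C.\<close>

lemma int_mat_inverse_comm:
  fixes B C :: "int mat"
  assumes B: "B \<in> carrier_mat k k" and C: "C \<in> carrier_mat k k" and BC: "B * C = 1\<^sub>m k"
  shows "C * B = 1\<^sub>m k"
proof -
  have unit: "det C * det B = 1"
    using det_mult[OF B C] BC by (simp add: mult.commute)
  define B' where "B' = det C \<cdot>\<^sub>m adj_mat B"
  have B': "B' \<in> carrier_mat k k" using adj_mat(1)[OF B] by (simp add: B'_def)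
  have "B' * B = det C \<cdot>\<^sub>m (det B \<cdot>\<^sub>m 1\<^sub>m k)"
    using adj_mat[OF B] B by (simp add: B'_def mult_smult_assoc_mat[of _ k k _ k])
  also have "\<dots> = 1\<^sub>m k"
    by (rule eq_matI) (auto simp: unit)
  finally have B'B: "B' * B = 1\<^sub>m k" .
  have "B' = B' * (B * C)" using B' BC by simp
  also have "\<dots> = B' * B * C" using assoc_mult_mat[OF B' B C] by simp
  also have "\<dots> = C" using B'B C by simp
  finally show ?thesis using B'B by simp
qed

text \<open>A list of exactly as many vectors as there are coordinates is a lattice basis as soon as it spans the
  unit vectors: their coefficients are the columns of a right inverse. Only the values on the listed
  coordinates matter, so spanning is required up to agreement there.\<close>

lemma column_mat_inverse:
  assumes dist: "distinct vs" and len: "length bs = length vs"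
    and span: "\<And>S. S \<in> set vs \<Longrightarrow>
      \<exists>g \<in> int_span.span (set bs). \<forall>T \<in> set vs. g T = of_bool (T = S)"
  obtains C where "C \<in> carrier_mat (length vs) (length vs)"
    "column_mat vs bs * C = 1\<^sub>m (length vs)" "C * column_mat vs bs = 1\<^sub>m (length vs)"
proof -
  define k where "k = length vs"
  have "\<forall>j<k. \<exists>c. \<forall>T \<in> set vs. (\<Sum>i<k. of_int (c i) * bs ! i) T = of_bool (T = vs ! j)"
  proof (intro allI impI)
    fix j assume "j < k"
    then have "vs ! j \<in> set vs" by (simp add: k_def)
    then obtain g where g: "g \<in> int_span.span (set bs)" "\<forall>T \<in> set vs. g T = of_bool (T = vs ! j)"
      using span by blast
    from span_list_combination[OF g(1)] g(2) show
      "\<exists>c. \<forall>T \<in> set vs. (\<Sum>i<k. of_int (c i) * bs ! i) T = of_bool (T = vs ! j)"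
      by (metis k_def len)
  qed
  then obtain c where c: "\<And>j T. j < k \<Longrightarrow> T \<in> set vs \<Longrightarrow>
      (\<Sum>i<k. of_int (c j i) * bs ! i) T = of_bool (T = vs ! j)"
    by metis
  define C where "C = mat k k (\<lambda>(i, j). c j i)"
  have C: "C \<in> carrier_mat k k" by (simp add: C_def)
  have B: "column_mat vs bs \<in> carrier_mat k k" by (simp add: column_mat_def k_def len)
  have BC: "column_mat vs bs * C = 1\<^sub>m k"
  proof (rule eq_matI)
    fix i j assume "i < dim_row (1\<^sub>m k)" "j < dim_col (1\<^sub>m k)"
    then have ij: "i < k" "j < k" by auto
    have "(column_mat vs bs * C) $$ (i, j) = (\<Sum>r<k. (bs ! r) (vs ! i) * c j r)"
      using ij by (simp add: column_mat_def C_def scalar_prod_def k_def len atLeast0LessThan)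
    also have "\<dots> = (\<Sum>r<k. of_int (c j r) * bs ! r) (vs ! i)"
      by (simp add: sum_fun_apply of_int_fun_apply mult.commute)
    also have "\<dots> = of_bool (vs ! i = vs ! j)"
      using c ij by (simp add: k_def)
    also have "\<dots> = 1\<^sub>m k $$ (i, j)"
      using ij dist by (simp add: k_def nth_eq_iff_index_eq)
    finally show "(column_mat vs bs * C) $$ (i, j) = 1\<^sub>m k $$ (i, j)" .
  qed (use B C in auto)
  show thesis
    using that[of C] C BC int_mat_inverse_comm[OF B C BC] by (simp add: k_def)
qed

text \<open>Multiplying the vector of the combination by the integral inverse of the basis matrix recovers the
  coefficients c and shows that k divides each of them. Bases are needed in this form with k = 3,
  where it says that a basis stays linearly independent modulo 3.\<close>

lemma spanning_list_independent_mod: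
  fixes bs :: "('v \<Rightarrow> int) list"
  assumes dist: "distinct vs" and len: "length bs = length vs"
    and span: "\<And>S. S \<in> set vs \<Longrightarrow>
      \<exists>g \<in> int_span.span (set bs). \<forall>T \<in> set vs. g T = of_bool (T = S)"
    and comb: "(\<Sum>i<length bs. of_int (c i) * bs ! i) = of_int k * g"
    and i: "i < length bs"
  shows "k dvd c i"
proof -
  define N where "N = length vs"
  obtain C where C: "C \<in> carrier_mat N N"
    and CB: "C * column_mat vs bs = 1\<^sub>m N"
    using column_mat_inverse[OF dist len span] N_def by metis
  have B: "column_mat vs bs \<in> carrier_mat N N" by (simp add: column_mat_def N_def len)
  define x where "x = vec N c"
  define y where "y = vec N (\<lambda>i. g (vs ! i))"
  have x: "x \<in> carrier_vec N" and y: "y \<in> carrier_vec N" by (simp_all add: x_def y_def)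
  have Bx: "column_mat vs bs *\<^sub>v x = k \<cdot>\<^sub>v y"
  proof (rule eq_vecI)
    fix r assume "r < dim_vec (k \<cdot>\<^sub>v y)"
    then have r: "r < N" by (simp add: y_def)
    have "(column_mat vs bs *\<^sub>v x) $ r = (\<Sum>j<N. (bs ! j) (vs ! r) * c j)"
      using r by (simp add: column_mat_def x_def scalar_prod_def N_def len atLeast0LessThan)
    also have "\<dots> = (\<Sum>i<length bs. of_int (c i) * bs ! i) (vs ! r)"
      by (simp add: sum_fun_apply of_int_fun_apply mult.commute N_def len)
    also have "\<dots> = (k \<cdot>\<^sub>v y) $ r"
      using r by (simp add: comb y_def of_int_fun_apply)
    finally show "(column_mat vs bs *\<^sub>v x) $ r = (k \<cdot>\<^sub>v y) $ r" .
  qed (use B in \<open>auto simp: y_def\<close>)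
  have "x = 1\<^sub>m N *\<^sub>v x" using x by simp
  also have "\<dots> = C *\<^sub>v (column_mat vs bs *\<^sub>v x)"
    using assoc_mult_mat_vec[OF C B x] CB by simp
  also have "\<dots> = k \<cdot>\<^sub>v (C *\<^sub>v y)"
    using C y unfolding Bx by (intro eq_vecI) auto
  finally have "x $ i = k * (C *\<^sub>v y) $ i"
    using i C len by (metis N_def carrier_matD(1) dim_mult_mat_vec index_smult_vec(1))
  then show ?thesis using i len by (simp add: x_def N_def)
qed

section \<open>Diagonal forms from adapted bases\<close>

text \<open>The operator A carries the span of P into the span of Q, and in adapted generators it is diagonal
  with entries D. Linear independence is deliberately not part of the notion: it follows at the end
  from counting, so blocks can be combined by taking unions.\<close>

definition diag_block ::
  "('a::comm_ring_1 \<Rightarrow> 'a) \<Rightarrow> 'a set \<Rightarrow> 'a set \<Rightarrow> int multiset \<Rightarrow> bool" where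
  "diag_block A P Q D \<longleftrightarrow> (\<exists>ts. (\<forall>(p, q, d) \<in> set ts. A p = of_int d * q) \<and>
     int_span.span (fst ` set ts) = int_span.span P \<and>
     int_span.span ((fst \<circ> snd) ` set ts) = int_span.span Q \<and>
     mset (map (snd \<circ> snd) ts) = D)"

lemma span_Un_cong:
  assumes "int_span.span P = int_span.span P'" "int_span.span Q = int_span.span Q'"
  shows "int_span.span (P \<union> Q) = int_span.span (P' \<union> (Q' :: 'a::comm_ring_1 set))"
  using assms by (simp add: int_span.span_Un)

lemma diag_block_Un:
  assumes "diag_block A P1 Q1 D1" "diag_block A P2 Q2 D2"
  shows "diag_block A (P1 \<union> P2) (Q1 \<union> Q2) (D1 + D2)"
proof -
  from assms(1) obtain s where s: "\<forall>(p, q, d) \<in> set s. A p = of_int d * q"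
     "int_span.span (fst ` set s) = int_span.span P1"
     "int_span.span ((fst \<circ> snd) ` set s) = int_span.span Q1"
     "mset (map (snd \<circ> snd) s) = D1" unfolding diag_block_def by blast
  from assms(2) obtain t where t: "\<forall>(p, q, d) \<in> set t. A p = of_int d * q"
     "int_span.span (fst ` set t) = int_span.span P2"
     "int_span.span ((fst \<circ> snd) ` set t) = int_span.span Q2"
     "mset (map (snd \<circ> snd) t) = D2" unfolding diag_block_def by blast
  have "\<forall>(p, q, d) \<in> set (s @ t). A p = of_int d * q" using s(1) t(1) by auto
  moreover have "int_span.span (fst ` set (s @ t)) = int_span.span (P1 \<union> P2)"
    using span_Un_cong[OF s(2) t(2)] by (simp add: image_Un)
  moreover have "int_span.span ((fst \<circ> snd) ` set (s @ t)) = int_span.span (Q1 \<union> Q2)"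
    using span_Un_cong[OF s(3) t(3)] by (simp add: image_Un)
  moreover have "mset (map (snd \<circ> snd) (s @ t)) = D1 + D2" using s(4) t(4) by simp
  ultimately show ?thesis unfolding diag_block_def by blast
qed

lemma diag_block_empty: "diag_block A {} {} {#}"
  unfolding diag_block_def by (rule exI[of _ "[]"]) simp

lemma diag_block_UN:
  fixes k :: nat
  assumes "\<And>i. i < k \<Longrightarrow> diag_block A (P i) (Q i) D"
  shows "diag_block A (\<Union>i<k. P i) (\<Union>i<k. Q i) (\<Sum>i<k. D)"
  using assms
proof (induction k)
  case 0
  then show ?case by (simp add: diag_block_empty)
next
  case (Suc k)
  have "diag_block A (\<Union>i<k. P i) (\<Union>i<k. Q i) (\<Sum>i<k. D)" using Suc by simp
  from diag_block_Un[OF this Suc.prems[of k]] show ?case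
    by (simp add: lessThan_Suc Un_commute add.commute)
qed

lemma diag_block_insert:
  assumes "diag_block A P Q D" "A p = of_int d * q"
  shows "diag_block A (insert p P) (insert q Q) (add_mset d D)"
proof -
  have "diag_block A {p} {q} {#d#}"
    unfolding diag_block_def using assms(2) by (intro exI[of _ "[(p, q, d)]"]) simp
  from diag_block_Un[OF this assms(1)] show ?thesis by simp
qed

lemma diag_block_span_cong:
  assumes "diag_block A P Q D" "int_span.span P = int_span.span P'" "int_span.span Q = int_span.span Q'"
  shows "diag_block A P' Q' D"
  using assms unfolding diag_block_def by metis

text \<open>If D has as many entries as there are vertices and both sides span all unit vectors, then the
  generators p and q are the columns of unimodular matrices, and A p = d q says that
  (inverse of q-matrix) * adjacency matrix * (p-matrix) is diagonal.\<close>

lemma diagonal_form_of_diag_block: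
  fixes adj :: "'v \<Rightarrow> 'v \<Rightarrow> bool" and A :: "('v \<Rightarrow> int) \<Rightarrow> ('v \<Rightarrow> int)"
  assumes dist: "distinct vs"
    and A: "\<And>g S. S \<in> set vs \<Longrightarrow> A g S = (\<Sum>T \<in> {T \<in> set vs. adj S T}. g T)"
    and block: "diag_block A P Q D" and size: "size D = length vs"
    and P: "\<And>S. S \<in> set vs \<Longrightarrow> \<exists>g \<in> int_span.span P. \<forall>T \<in> set vs. g T = of_bool (T = S)"
    and Q: "\<And>S. S \<in> set vs \<Longrightarrow> \<exists>g \<in> int_span.span Q. \<forall>T \<in> set vs. g T = of_bool (T = S)"
  shows "\<exists>M. diagonal_form (adjacency_mat adj vs) M \<and> mset (diag_mat M) = D"
proof -
  from block obtain ts where ts: "\<forall>(p, q, d) \<in> set ts. A p = of_int d * q"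
     "int_span.span (fst ` set ts) = int_span.span P"
     "int_span.span ((fst \<circ> snd) ` set ts) = int_span.span Q"
     "mset (map (snd \<circ> snd) ts) = D" unfolding diag_block_def by blast
  define k where "k = length vs"
  have len: "length ts = k" using ts(4) size by (auto simp: k_def)
  define p where "p = map fst ts"
  define q where "q = map (fst \<circ> snd) ts"
  define d where "d = map (snd \<circ> snd) ts"
  obtain P' where P': "P' \<in> carrier_mat k k" "column_mat vs p * P' = 1\<^sub>m k" "P' * column_mat vs p = 1\<^sub>m k"
    using column_mat_inverse[of vs p] dist len P ts(2) by (auto simp: k_def p_def)
  obtain Q' where Q': "Q' \<in> carrier_mat k k" "column_mat vs q * Q' = 1\<^sub>m k" "Q' * column_mat vs q = 1\<^sub>m k"
    using column_mat_inverse[of vs q] dist len Q ts(3) by (auto simp: k_def q_def)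
  let ?A = "adjacency_mat adj vs"
  have cA: "?A \<in> carrier_mat k k" by (simp add: adjacency_mat_def k_def)
  have cp: "column_mat vs p \<in> carrier_mat k k" and cq: "column_mat vs q \<in> carrier_mat k k"
    using len by (simp_all add: column_mat_def p_def q_def k_def)
  define M where "M = mat k k (\<lambda>(i, j). if i = j then d ! i else 0)"
  have cM: "M \<in> carrier_mat k k" by (simp add: M_def)
  have AP: "?A * column_mat vs p = column_mat vs q * M"
  proof (rule eq_matI)
    fix i j assume "i < dim_row (column_mat vs q * M)" "j < dim_col (column_mat vs q * M)"
    then have ij: "i < k" "j < k" using cq cM by auto
    have mem: "(p ! j, q ! j, d ! j) \<in> set ts"
      using ij len by (simp add: p_def q_def d_def)
    have "(?A * column_mat vs p) $$ (i, j) =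
        (\<Sum>r<k. (if adj (vs ! i) (vs ! r) then 1 else 0) * (p ! j) (vs ! r))"
      using ij len by (simp add: adjacency_mat_def column_mat_def scalar_prod_def p_def k_def atLeast0LessThan)
    also have "\<dots> = (\<Sum>T\<in>set vs. (if adj (vs ! i) T then 1 else 0) * (p ! j) T)"
      by (rule sum.reindex_bij_betw[of "(!) vs" "{..<k}" "set vs"])
        (simp add: bij_betw_nth[OF dist] k_def)
    also have "\<dots> = (\<Sum>T \<in> {T \<in> set vs. adj (vs ! i) T}. (p ! j) T)"
      by (subst sum.inter_filter) (auto intro!: sum.cong)
    also have "\<dots> = A (p ! j) (vs ! i)" using A[of "vs ! i"] ij by (simp add: k_def)
    also have "\<dots> = (q ! j) (vs ! i) * d ! j" using bspec[OF ts(1) mem] by (simp add: of_int_fun_apply)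
    also have "\<dots> = (\<Sum>r<k. (q ! r) (vs ! i) * (if r = j then d ! r else 0))"
      using ij by (simp add: if_distrib cong: if_cong)
    also have "\<dots> = (column_mat vs q * M) $$ (i, j)"
      using ij len by (simp add: M_def column_mat_def scalar_prod_def q_def k_def atLeast0LessThan)
    finally show "(?A * column_mat vs p) $$ (i, j) = (column_mat vs q * M) $$ (i, j)" .
  qed (use cA cp cq cM in auto)
  have "Q' * ?A * column_mat vs p = Q' * (column_mat vs q * M)"
    using assoc_mult_mat[OF Q'(1) cA cp] AP by simp
  also have "\<dots> = M" using assoc_mult_mat[OF Q'(1) cq cM] Q'(3) cM by simp
  finally have eq: "Q' * ?A * column_mat vs p = M" .
  have "inverts_mat Q' (column_mat vs q)" "inverts_mat (column_mat vs q) Q'"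
    "inverts_mat (column_mat vs p) P'" "inverts_mat P' (column_mat vs p)"
    using P' Q' cp cq by (simp_all add: inverts_mat_def)
  then have uni: "unimodular Q'" "unimodular (column_mat vs p)"
    using Q'(1) cp unfolding unimodular_def invertible_mat_def by auto
  have diag: "diagonal_mat M" by (simp add: diagonal_mat_def M_def)
  have dims: "dim_row ?A = k" "dim_col ?A = k" using cA by auto
  have "diagonal_form ?A M"
    unfolding diagonal_form_def dims using cM diag Q'(1) uni cp eq by blast
  moreover have "diag_mat M = d"
    using len by (intro nth_equalityI) (simp_all add: diag_mat_def M_def d_def)
  ultimately show ?thesis using ts(4) d_def by auto
qed

section \<open>An exchange lemma modulo 3\<close>

text \<open>Either all coefficients of x can be taken divisible by 3, or one of them is 1 or -1 modulo 3, where
  the sign e is recorded by e * e = 1. In the second case b can be exchanged for e * b + r without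
  changing the lattice, because the coefficient e is a unit; this is why the prime 3 is harmless here.\<close>

lemma span_list_split_mod_3:
  fixes x :: "'a::comm_ring_1"
  assumes "x \<in> int_span.span (set bs)"
  shows "(\<exists>y \<in> int_span.span (set bs). x = 3 * y) \<or>
    (\<exists>bs1 b bs2 e k r. bs = bs1 @ b # bs2 \<and> e * e = 1 \<and>
       r \<in> int_span.span (set (bs1 @ bs2)) \<and> x = of_int (e + 3 * k) * b + r)"
  using assms
proof (induction bs arbitrary: x)
  case Nil
  then show ?case by auto
next
  case (Cons b bs)
  then obtain c where c: "x - of_int c * b \<in> int_span.span (set bs)"
    by (auto simp: int_span.span_insert)
  consider k where "c = 3 * k" | e k where "c = e + 3 * k" "e * e = 1"
  proof -
    have "c = 3 * (c div 3) \<or> c = 1 + 3 * (c div 3) \<or> c = -1 + 3 * (c div 3 + 1)" by presburger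
    then show thesis using that by (metis mult_1 mult_minus_left minus_minus)
  qed
  then show ?case
  proof cases
    case (1 k)
    from Cons.IH[OF c] show ?thesis
    proof (elim disjE bexE exE conjE)
      fix y assume y: "y \<in> int_span.span (set bs)" "x - of_int c * b = 3 * y"
      have "x = 3 * (y + of_int k * b)" using y(2) 1 by (simp add: algebra_simps)
      moreover have "y + of_int k * b \<in> int_span.span (set (b # bs))"
        using y(1) by (intro int_span.span_add int_span.span_scale int_span.span_base[of b])
          (auto intro: int_span.span_mono[THEN subsetD, of "set bs"])
      ultimately show ?thesis by blast
    next
      fix bs1 b' bs2 e l r
      assume *: "bs = bs1 @ b' # bs2" "e * e = 1" "r \<in> int_span.span (set (bs1 @ bs2))"
        "x - of_int c * b = of_int (e + 3 * l) * b' + r"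
      have "b # bs = (b # bs1) @ b' # bs2" using * by simp
      moreover have "r + of_int c * b \<in> int_span.span (set ((b # bs1) @ bs2))"
        using *(3) by (intro int_span.span_add int_span.span_scale int_span.span_base[of b])
          (auto intro: int_span.span_mono[THEN subsetD, of "set (bs1 @ bs2)"])
      moreover have "x = of_int (e + 3 * l) * b' + (r + of_int c * b)"
        using *(4) by (simp add: algebra_simps)
      ultimately show ?thesis using *(2) by blast
    qed
  next
    case (2 e k)
    have "b # bs = [] @ b # bs" by simp
    moreover have "x - of_int c * b \<in> int_span.span (set ([] @ bs))" using c by simp
    moreover have "x = of_int (e + 3 * k) * b + (x - of_int c * b)" using 2 by simp
    ultimately show ?thesis using 2(2) by blast
  qed
qed

text \<open>Steinitz exchange over the field with three elements, lifted to the integers. The generators ws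
  constructed so far have images bs modulo M. A preimage x of the next target b has to involve one of
  the remaining generators with a coefficient that is nonzero modulo 3, for otherwise b would be
  dependent on bs modulo M. Changing x by three times that generator makes the coefficient a unit and
  does not change the image modulo M.\<close>

lemma exchange_mod_3:
  fixes f :: "'a::comm_ring_1 \<Rightarrow> 'a"
  assumes f: "int_linear f" and M: "int_span.subspace M"
    and three: "\<And>x. x \<in> int_span.span (set rs) \<Longrightarrow> 3 * f x \<in> M"
    and indep: "\<And>c i. (\<Sum>i<length bs. of_int (c i) * bs ! i) \<in> M \<Longrightarrow> i < length bs \<Longrightarrow> 3 dvd c i"
    and cover: "\<And>b. b \<in> set bs \<Longrightarrow> \<exists>x \<in> int_span.span (set rs). f x - b \<in> M"
  shows "\<exists>ws os. length ws = length bs \<and> length ws + length os = length rs \<and>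
    int_span.span (set (ws @ os)) = int_span.span (set rs) \<and>
    (\<forall>i<length bs. f (ws ! i) - bs ! i \<in> M)"
  using indep cover
proof (induction bs rule: rev_induct)
  case Nil
  show ?case by (intro exI[of _ "[]"] exI[of _ rs]) simp
next
  case (snoc b bs)
  have indep': "3 dvd c i" if "(\<Sum>i<length bs. of_int (c i) * bs ! i) \<in> M" "i < length bs" for c i
  proof -
    define c' where "c' = c(length bs := 0)"
    have "(\<Sum>i<length (bs @ [b]). of_int (c' i) * (bs @ [b]) ! i) = (\<Sum>i<length bs. of_int (c i) * bs ! i)"
      by (auto simp: c'_def nth_append intro!: sum.cong)
    then have "3 dvd c' i" using snoc.prems(1)[of c' i] that by simp
    then show ?thesis using that(2) by (simp add: c'_def)
  qed
  have "\<exists>ws os. length ws = length bs \<and> length ws + length os = length rs \<and>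
      int_span.span (set (ws @ os)) = int_span.span (set rs) \<and>
      (\<forall>i<length bs. f (ws ! i) - bs ! i \<in> M)"
    by (rule snoc.IH) (use indep' snoc.prems(2) in auto)
  then obtain ws os where ws: "length ws = length bs" "length ws + length os = length rs"
    "int_span.span (set (ws @ os)) = int_span.span (set rs)"
    "\<And>i. i < length bs \<Longrightarrow> f (ws ! i) - bs ! i \<in> M"
    by blast
  obtain x where x: "x \<in> int_span.span (set rs)" "f x - b \<in> M"
    using snoc.prems(2)[of b] by auto
  obtain x1 x2 where x12: "x = x1 + x2" "x1 \<in> int_span.span (set ws)" "x2 \<in> int_span.span (set os)"
    using x(1) ws(3)[symmetric] unfolding set_append int_span.span_Un by blast
  interpret f: Modules.module_hom "\<lambda>c x. of_int c * x" "\<lambda>c x. of_int c * x" f by (rule f)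
  have f3: "f (3 * y) = 3 * f y" for y using f.scale[of 3 y] by simp
  from span_list_split_mod_3[OF x12(3)] show ?case
  proof (elim disjE bexE exE conjE)
    fix y assume y: "y \<in> int_span.span (set os)" "x2 = 3 * y"
    have "f x2 \<in> M"
      using three[of y] y ws(3) int_span.span_mono[of "set os" "set (ws @ os)"] by (auto simp: f3)
    obtain c where c: "x1 = (\<Sum>i<length ws. of_int (c i) * ws ! i)"
      using span_list_combination[OF x12(2)] by blast
    define c' where "c' = c(length bs := -1)"
    have "f x1 = (\<Sum>i<length bs. of_int (c i) * f (ws ! i))"
      using ws(1) by (simp add: c f.sum f.scale)
    then have "(\<Sum>i<length (bs @ [b]). of_int (c' i) * (bs @ [b]) ! i) =
        f x - b - f x2 - (\<Sum>i<length bs. of_int (c i) * (f (ws ! i) - bs ! i))"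
      by (simp add: c'_def nth_append x12 f.add sum_subtractf algebra_simps)
    also have "\<dots> \<in> M"
      by (intro int_span.subspace_diff[OF M] int_span.subspace_sum[OF M] int_span.subspace_scale[OF M]
          x(2) \<open>f x2 \<in> M\<close> ws(4)) simp
    \<comment> \<open>The coefficient of b is -1, so this divisibility is absurd.\<close>
    finally have "3 dvd c' (length bs)" using snoc.prems(1)[of c' "length bs"] by simp
    then show ?thesis by (simp add: c'_def)
  next
    fix os1 w os2 e k r
    assume *: "os = os1 @ w # os2" "e * e = 1" "r \<in> int_span.span (set (os1 @ os2))"
      "x2 = of_int (e + 3 * k) * w + r"
    define w' where "w' = x1 + of_int e * w + r"
    have w: "w \<in> int_span.span (set rs)"
      using int_span.span_base[of w "set (ws @ os)"] * ws(3) by auto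
    have "f w' - b = f x - b - of_int k * (3 * f w)"
      unfolding w'_def x12 * f.add f.scale by (simp add: algebra_simps)
    also have "\<dots> \<in> M"
      by (intro int_span.subspace_diff[OF M] int_span.subspace_scale[OF M] x(2) three[OF w])
    finally have fw': "f w' - b \<in> M" .
    have "int_span.span (set ((ws @ [w']) @ os1 @ os2)) = int_span.span (set (ws @ os))"
    proof (rule int_span.span_eq[THEN iffD2], intro conjI)
      have mem: "x1 \<in> int_span.span (set (ws @ os))" "r \<in> int_span.span (set (ws @ os))"
        "w \<in> int_span.span (set (ws @ os))"
        using x12(2) *(3) * int_span.span_mono[of "set ws" "set (ws @ os)"]
          int_span.span_mono[of "set (os1 @ os2)" "set (ws @ os)"] int_span.span_base[of w "set (ws @ os)"]
        by auto
      have "w' \<in> int_span.span (set (ws @ os))"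
        unfolding w'_def using mem by (intro int_span.span_add int_span.span_scale)
      then show "set ((ws @ [w']) @ os1 @ os2) \<subseteq> int_span.span (set (ws @ os))"
        using * by (auto intro: int_span.span_base)
    next
      let ?S = "int_span.span (set ((ws @ [w']) @ os1 @ os2))"
      have "w = of_int e * (w' - x1 - r)"
      proof -
        have "of_int e * (w' - x1 - r) = of_int (e * e) * w" by (simp add: w'_def algebra_simps)
        then show ?thesis using *(2) by simp
      qed
      moreover have "x1 \<in> ?S" "r \<in> ?S" "w' \<in> ?S"
        using x12(2) *(3) int_span.span_mono[of "set ws" "set ((ws @ [w']) @ os1 @ os2)"]
          int_span.span_mono[of "set (os1 @ os2)" "set ((ws @ [w']) @ os1 @ os2)"]
          int_span.span_base[of w' "set ((ws @ [w']) @ os1 @ os2)"]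
        by auto
      ultimately have "w \<in> ?S" by (metis int_span.span_diff int_span.span_scale)
      then show "set (ws @ os) \<subseteq> ?S"
        using * by (auto intro: int_span.span_base)
    qed
    then show ?thesis
      using ws * fw' by (intro exI[of _ "ws @ [w']"] exI[of _ "os1 @ os2"])
        (auto simp: nth_append less_Suc_eq)
  qed
qed

section \<open>Invariant blocks of rank two and three\<close>

text \<open>The matrix with rows (-3, 1) and (0, a) has coprime entries and determinant -3 a.
  Here s stands for w minus some element of N.\<close>

lemma diag_block_pair:
  fixes w y s :: "'a::comm_ring_1"
  assumes A: "int_linear A" and y: "A y = of_int a * y" and w: "A w = y - 3 * s"
  shows "diag_block A {w, y} {s, y} {#1, 3 * a#}"
proof -
  interpret A: Modules.module_hom "\<lambda>c x. of_int c * x" "\<lambda>c x. of_int c * x" A by (rule A)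
  note span = int_span.span_add int_span.span_diff int_span.span_scale int_span.span_base
  define c where "c = y - of_int a * w"
  define r where "r = y - of_int 3 * s"
  have "A c = of_int (3 * a) * s"
    unfolding c_def A.diff A.scale y w by (simp add: algebra_simps)
  moreover have "A w = of_int 1 * r" by (simp add: w r_def)
  ultimately have "diag_block A {w, c} {r, s} {#1, 3 * a#}"
    by (intro diag_block_insert diag_block_empty)
  moreover have "int_span.span {w, c} = int_span.span {w, y}"
  proof (rule int_span.span_eq[THEN iffD2], intro conjI)
    have y: "y = c + of_int a * w" by (simp add: c_def)
    have "y \<in> int_span.span {w, c}" unfolding y by (intro span) simp_all
    then show "{w, y} \<subseteq> int_span.span {w, c}" by (simp add: int_span.span_base)
    have "c \<in> int_span.span {w, y}" unfolding c_def by (intro span) simp_all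
    then show "{w, c} \<subseteq> int_span.span {w, y}" by (simp add: int_span.span_base)
  qed
  moreover have "int_span.span {r, s} = int_span.span {s, y}"
  proof (rule int_span.span_eq[THEN iffD2], intro conjI)
    have y: "y = r + of_int 3 * s" by (simp add: r_def)
    have "y \<in> int_span.span {r, s}" unfolding y by (intro span) simp_all
    then show "{s, y} \<subseteq> int_span.span {r, s}" by (simp add: int_span.span_base)
    have "r \<in> int_span.span {s, y}" unfolding r_def by (intro span) simp_all
    then show "{r, s} \<subseteq> int_span.span {s, y}" by (simp add: int_span.span_base)
  qed
  ultimately show ?thesis by (rule diag_block_span_cong)
qed

text \<open>The matrix with rows (-3, 1, 0), (0, a, 2), (0, 0, 2 j + 1) has two invariant factors 1, because
  2 and 2 j + 1 are coprime. The vector c below removes t from the image of v; combining c and u with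
  the Bezout relation (2 j + 1) - 2 j = 1 produces a primitive image, and d spans what remains.\<close>

lemma diag_block_triple:
  fixes t v u s :: "'a::comm_ring_1"
  assumes A: "int_linear A" and u: "A u = of_int (2 * j + 1) * u"
    and v: "A v = of_int a * v + 2 * u" and t: "A t = v - 3 * s"
  shows "diag_block A {t, v, u} {s, v, u} {#1, 1, 3 * (2 * j + 1) * a#}"
proof -
  interpret A: Modules.module_hom "\<lambda>c x. of_int c * x" "\<lambda>c x. of_int c * x" A by (rule A)
  note span = int_span.span_add int_span.span_diff int_span.span_scale int_span.span_base
  define c where "c = v - of_int a * t"
  define b where "b = u - of_int j * c"
  define d where "d = of_int (2 * j + 1) * c - of_int 2 * u"
  define q where "q = u - of_int (3 * j * a) * s"
  define r where "r = v - of_int 3 * s"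
  have Ac: "A c = of_int 2 * u + of_int (3 * a) * s"
    unfolding c_def A.diff A.scale v t by (simp add: algebra_simps)
  have "A t = of_int 1 * r" by (simp add: t r_def)
  moreover have "A b = of_int 1 * q"
    unfolding b_def q_def A.diff A.scale Ac u by (simp add: ring_distribs ac_simps)
  moreover have "A d = of_int (3 * (2 * j + 1) * a) * s"
    unfolding d_def A.diff A.scale Ac u by (simp add: ring_distribs ac_simps)
  ultimately have "diag_block A {t, b, d} {r, q, s} {#1, 1, 3 * (2 * j + 1) * a#}"
    by (intro diag_block_insert diag_block_empty)
  moreover have "int_span.span {t, b, d} = int_span.span {t, v, u}"
  proof (rule int_span.span_eq[THEN iffD2], intro conjI)
    have c: "c = d + of_int 2 * b" by (simp add: b_def d_def algebra_simps)
    have v: "v = c + of_int a * t" by (simp add: c_def)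
    have u: "u = b + of_int j * c" by (simp add: b_def)
    have "v \<in> int_span.span {t, b, d}" unfolding v c by (intro span) simp_all
    moreover have "u \<in> int_span.span {t, b, d}" unfolding u c by (intro span) simp_all
    ultimately show "{t, v, u} \<subseteq> int_span.span {t, b, d}" by (simp add: int_span.span_base)
    have "b \<in> int_span.span {t, v, u}" unfolding b_def c_def by (intro span) simp_all
    moreover have "d \<in> int_span.span {t, v, u}" unfolding d_def c_def by (intro span) simp_all
    ultimately show "{t, b, d} \<subseteq> int_span.span {t, v, u}" by (simp add: int_span.span_base)
  qed
  moreover have "int_span.span {r, q, s} = int_span.span {s, v, u}"
  proof (rule int_span.span_eq[THEN iffD2], intro conjI)
    have v: "v = r + of_int 3 * s" by (simp add: r_def)
    have u: "u = q + of_int (3 * j * a) * s" by (simp add: q_def)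
    have "v \<in> int_span.span {r, q, s}" unfolding v by (intro span) simp_all
    moreover have "u \<in> int_span.span {r, q, s}" unfolding u by (intro span) simp_all
    ultimately show "{s, v, u} \<subseteq> int_span.span {r, q, s}" by (simp add: int_span.span_base)
    have "r \<in> int_span.span {s, v, u}" unfolding r_def by (intro span) simp_all
    moreover have "q \<in> int_span.span {s, v, u}" unfolding q_def by (intro span) simp_all
    ultimately show "{r, q, s} \<subseteq> int_span.span {s, v, u}" by (simp add: int_span.span_base)
  qed
  ultimately show ?thesis by (rule diag_block_span_cong)
qed

text \<open>The block is triangular with diagonal a, 2 a + 5, c = 3 a + 12, that is, the three eigenvalues n - 7,
  2 n - 9 and 3 (n - 3). One invariant factor is 1: the image of z - x is a * (z - 2 x) - x - 3 * x0,
  in which x has the unit coefficient -1. The remaining two by two matrix has rows ((2 a + 5) a, 12)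
  and (0, c). Since g divides c, a Bezout relation for (2 a + 5) a and 12 diagonalises it.\<close>

lemma diag_block_core:
  fixes z x x0 :: "'a::comm_ring_1" and a b c g :: int
  assumes A: "int_linear A" and z: "A z = of_int a * z + 4 * x"
    and x: "A x = of_int (2 * a + 5) * x + 3 * x0" and x0: "A x0 = of_int c * x0"
    and c: "c = 3 * a + 12" and g: "g = gcd ((2 * a + 5) * a) 12" "g dvd c"
  shows "diag_block A {z, x, x0} {z, x, x0} {#c * a * (2 * a + 5) div g, g, 1#}"
proof -
  interpret A: Modules.module_hom "\<lambda>c x. of_int c * x" "\<lambda>c x. of_int c * x" A by (rule A)
  note span = int_span.span_add int_span.span_diff int_span.span_scale int_span.span_base
  define k where "k = 2 * a + 5"
  have g0: "g > 0" using g by simp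
  obtain m h where mh: "k * a = g * m" "12 = g * h"
    using g by (metis dvdE gcd_dvd1 gcd_dvd2 k_def)
  obtain i j where "i * (k * a) + j * 12 = g" using bezout_int g(1) k_def by metis
  then have "g * (i * m + j * h) = g * 1" unfolding mh by (simp add: algebra_simps)
  then have ij: "i * m + j * h = 1" using g0 by simp
  obtain e where e: "c = g * e" using g(2) by (rule dvdE)
  define y where "y = z - of_int 2 * x"
  \<comment> \<open>A (z - x) = a * z - (2 * a + 1) * x - 3 * x0 = a * (z - 2 * x) - x - 3 * x0, whence the coordinate y.\<close>
  define p1 where "p1 = z - of_int 1 * x"
  define q1 where "q1 = of_int a * y - of_int 1 * x - of_int 3 * x0"
  \<comment> \<open>The multiple of p1 clears the coefficient along q1; adding 2 * x0 turns the coefficient of x0 into 12.\<close>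
  define p2 where "p2 = x + of_int k * p1 + of_int 2 * x0"
  define q2 where "q2 = of_int m * y + of_int h * x0"
  define p3 where "p3 = x0 - of_int (e * j) * p2"
  define q3 where "q3 = of_int i * x0 - of_int j * y"
  have 1: "A p1 = of_int 1 * q1"
    unfolding p1_def q1_def y_def A.diff A.scale z x by (simp add: algebra_simps)
  have "A p2 = of_int (k * a) * y + of_int 12 * x0"
    unfolding p2_def A.add A.scale 1 x x0 q1_def c by (simp add: algebra_simps k_def)
  also have "\<dots> = of_int g * q2" unfolding mh q2_def by (simp add: algebra_simps)
  finally have 2: "A p2 = of_int g * q2" .
  have x0': "x0 = of_int m * q3 + of_int j * q2"
  proof -
    have "of_int m * q3 + of_int j * q2 = of_int (i * m + j * h) * x0"
      by (simp add: q2_def q3_def algebra_simps)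
    then show ?thesis using ij by simp
  qed
  have y': "y = of_int i * q2 - of_int h * q3"
  proof -
    have "of_int i * q2 - of_int h * q3 = of_int (i * m + j * h) * y"
      by (simp add: q2_def q3_def algebra_simps)
    then show ?thesis using ij by simp
  qed
  have "A p3 = of_int c * x0 - of_int (e * j * g) * q2"
    unfolding p3_def A.diff A.scale 2 x0 by (simp add: algebra_simps)
  also have "\<dots> = of_int (c * m) * q3"
    by (subst x0') (simp add: e algebra_simps)
  also have "c * m = c * a * (2 * a + 5) div g"
  proof -
    have "c * a * (2 * a + 5) = c * (k * a)" by (simp add: k_def)
    also have "\<dots> = g * (c * m)" by (simp add: mh(1))
    finally have "c * a * (2 * a + 5) = g * (c * m)" .
    then show ?thesis using g0 by (metis less_irrefl nonzero_mult_div_cancel_left)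
  qed
  finally have 3: "A p3 = of_int (c * a * (2 * a + 5) div g) * q3" .
  from 1 2 3 have "diag_block A {p3, p2, p1} {q3, q2, q1} {#c * a * (2 * a + 5) div g, g, 1#}"
    by (intro diag_block_insert diag_block_empty)
  moreover have "int_span.span {p3, p2, p1} = int_span.span {z, x, x0}"
  proof (rule int_span.span_eq[THEN iffD2], intro conjI)
    have x0: "x0 = p3 + of_int (e * j) * p2" by (simp add: p3_def)
    have x: "x = p2 - of_int k * p1 - of_int 2 * x0" by (simp add: p2_def)
    have z: "z = p1 + of_int 1 * x" by (simp add: p1_def)
    have "x0 \<in> int_span.span {p3, p2, p1}" unfolding x0 by (intro span) simp_all
    moreover have "x \<in> int_span.span {p3, p2, p1}" unfolding x x0 by (intro span) simp_all
    moreover have "z \<in> int_span.span {p3, p2, p1}" unfolding z x x0 by (intro span) simp_all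
    ultimately show "{z, x, x0} \<subseteq> int_span.span {p3, p2, p1}" by simp
    have "p1 \<in> int_span.span {z, x, x0}" unfolding p1_def by (intro span) simp_all
    moreover have "p2 \<in> int_span.span {z, x, x0}" unfolding p2_def p1_def by (intro span) simp_all
    moreover have "p3 \<in> int_span.span {z, x, x0}" unfolding p3_def p2_def p1_def by (intro span) simp_all
    ultimately show "{p3, p2, p1} \<subseteq> int_span.span {z, x, x0}" by simp
  qed
  moreover have "int_span.span {q3, q2, q1} = int_span.span {z, x, x0}"
  proof (rule int_span.span_eq[THEN iffD2], intro conjI)
    have x: "x = of_int a * y - of_int 3 * x0 - q1" by (simp add: q1_def)
    have z: "z = y + of_int 2 * x" by (simp add: y_def)
    have x0'': "x0 \<in> int_span.span {q3, q2, q1}" by (subst x0') (intro span; simp)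
    have y'': "y \<in> int_span.span {q3, q2, q1}" by (subst y') (intro span; simp)
    have q: "q1 \<in> int_span.span {q3, q2, q1}" by (intro span; simp)
    have x': "x \<in> int_span.span {q3, q2, q1}" unfolding x
      by (intro int_span.span_diff int_span.span_scale x0'' y'' q)
    have "z \<in> int_span.span {q3, q2, q1}" unfolding z
      by (intro int_span.span_add int_span.span_scale x' y'')
    with x' x0'' show "{z, x, x0} \<subseteq> int_span.span {q3, q2, q1}" by simp
    have "q1 \<in> int_span.span {z, x, x0}" unfolding q1_def y_def by (intro span) simp_all
    moreover have "q2 \<in> int_span.span {z, x, x0}" unfolding q2_def y_def by (intro span) simp_all
    moreover have "q3 \<in> int_span.span {z, x, x0}" unfolding q3_def y_def by (intro span) simp_all
    ultimately show "{q3, q2, q1} \<subseteq> int_span.span {z, x, x0}" by simp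
  qed
  ultimately show ?thesis by (rule diag_block_span_cong)
qed

section \<open>The adjacency operator on stars\<close>

text \<open>The point n is used to eliminate the triples that contain it, and m is singled out among the
  remaining points. Naming m and l avoids subtraction on natural numbers.\<close>

locale johnson_triples =
  fixes n m l :: nat
  assumes l5: "5 \<le> l" and m: "m = Suc l" and n: "n = Suc m"
begin

lemma bounds: "5 \<le> l" "l < m" "m < n" "6 \<le> m" "7 \<le> n"
  using l5 m n by auto

lemma le_m_iff: "a \<le> m \<longleftrightarrow> a \<le> l \<or> a = m"
  and le_n_iff: "a \<le> n \<longleftrightarrow> a \<le> m \<or> a = n"
  using m n by auto

definition star :: "nat set \<Rightarrow> nat set \<Rightarrow> int" where
  "star T = (\<lambda>S. of_bool (S \<in> johnson_verts n 3 \<and> T \<subseteq> S))"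

definition A :: "(nat set \<Rightarrow> int) \<Rightarrow> nat set \<Rightarrow> int" where
  "A g = (\<lambda>S. \<Sum>T | johnson_adj n 3 2 S T. g T)"

lemma A_linear: "int_linear A"
  by unfold_locales
    (auto simp: A_def fun_eq_iff sum.distrib sum_distrib_left of_int_fun_apply)

lemma vertsD:
  assumes "S \<in> johnson_verts n 3"
  shows "S \<subseteq> {1..n}" "finite S" "card S = 3"
  using assms by (auto simp: johnson_verts_def intro: finite_subset)

text \<open>A neighbour of S arises by exchanging one element s of S for one point t outside S, in a unique way.\<close>

lemma sum_neighbours:
  assumes S: "S \<in> johnson_verts n 3"
  shows "(\<Sum>T | johnson_adj n 3 2 S T. g T) =
    (\<Sum>s\<in>S. \<Sum>t\<in>{1..n} - S. g (insert t (S - {s})))"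
proof -
  note S' = vertsD[OF S]
  have "bij_betw (\<lambda>(s, t). insert t (S - {s})) (S \<times> ({1..n} - S)) {T. johnson_adj n 3 2 S T}"
  proof (rule bij_betwI')
    have recover: "S - insert t (S - {s}) = {s}" "insert t (S - {s}) - S = {t}"
      if "s \<in> S" "t \<notin> S" for s t using that by auto
    fix p q assume "p \<in> S \<times> ({1..n} - S)" "q \<in> S \<times> ({1..n} - S)"
    then obtain s t s' t' where *: "p = (s, t)" "s \<in> S" "t \<notin> S" "q = (s', t')" "s' \<in> S" "t' \<notin> S"
      by auto
    have "s = s' \<and> t = t'" if "insert t (S - {s}) = insert t' (S - {s'})"
      using recover[OF *(2,3)] recover[OF *(5,6)] unfolding that by simp
    then show "((\<lambda>(s, t). insert t (S - {s})) p = (\<lambda>(s, t). insert t (S - {s})) q) = (p = q)"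
      using * by auto
  next
    fix p assume p: "p \<in> S \<times> ({1..n} - S)"
    obtain s t where st: "p = (s, t)" "s \<in> S" "t \<in> {1..n}" "t \<notin> S" using p by auto
    have "S \<inter> insert t (S - {s}) = S - {s}" using st by auto
    moreover have "card (S - {s}) = 2" using st S' by simp
    ultimately show "(\<lambda>(s, t). insert t (S - {s})) p \<in> {T. johnson_adj n 3 2 S T}"
      using st S S' by (auto simp: johnson_adj_def johnson_verts_def)
  next
    fix T assume "T \<in> {T. johnson_adj n 3 2 S T}"
    then have T: "T \<in> johnson_verts n 3" "card (S \<inter> T) = 2"
      by (auto simp: johnson_adj_def)
    note T' = vertsD[OF T(1)]
    have "card (S - T) = 1" "card (T - S) = 1"
      using T(2) S' T' by (simp_all add: card_Diff_subset_Int Int_commute)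
    then obtain s t where st: "S - T = {s}" "T - S = {t}" by (metis card_1_singletonE)
    then have "T = insert t (S - {s})" "s \<in> S" "t \<in> {1..n} - S" using T' by auto
    then show "\<exists>p \<in> S \<times> ({1..n} - S). T = (\<lambda>(s, t). insert t (S - {s})) p"
      by (intro bexI[of _ "(s, t)"]) auto
  qed
  then have "(\<Sum>T | johnson_adj n 3 2 S T. g T) =
      (\<Sum>p\<in>S \<times> ({1..n} - S). g ((\<lambda>(s, t). insert t (S - {s})) p))"
    by (metis (no_types, lifting) sum.cong sum.reindex_bij_betw)
  also have "\<dots> = (\<Sum>s\<in>S. \<Sum>t\<in>{1..n} - S. g (insert t (S - {s})))"
    by (simp add: sum.cartesian_product split_def)
  finally show ?thesis .
qed

text \<open>If T is contained in S, a neighbour of S still contains T exactly when the exchanged point s lies outside T.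
  Otherwise the incoming point t must be the only element of T missing from S, which is
  what the sum over T - {a} detects; the factor 4 - card T then counts the admissible points s.\<close>

lemma A_star:
  assumes T: "T \<subseteq> {1..n}"
  shows "A (star T) = of_int ((3 - int (card T)) * (int n - 3) - int (card T) * (4 - int (card T))) * star T
    + of_int (4 - int (card T)) * (\<Sum>a\<in>T. star (T - {a}))"
proof
  fix S
  have finT: "finite T" using T finite_subset by blast
  show "A (star T) S = (of_int ((3 - int (card T)) * (int n - 3) - int (card T) * (4 - int (card T))) * star T
    + of_int (4 - int (card T)) * (\<Sum>a\<in>T. star (T - {a}))) S"
  proof (cases "S \<in> johnson_verts n 3")
    case False
    then show ?thesis by (simp add: A_def star_def johnson_adj_def sum_fun_apply)
  next
    case S: True
    note S' = vertsD[OF S]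
    have mem: "insert t (S - {s}) \<in> johnson_verts n 3" if "s \<in> S" "t \<in> {1..n} - S" for s t
      using that S' by (auto simp: johnson_verts_def)
    have "A (star T) S = (\<Sum>s\<in>S. \<Sum>t\<in>{1..n} - S. of_bool (T \<subseteq> insert t (S - {s})))"
      unfolding A_def sum_neighbours[OF S] using mem by (simp add: star_def)
    also have "\<dots> = (\<Sum>s\<in>S. of_bool (s \<notin> T) * (\<Sum>t\<in>{1..n} - S. of_bool (T - {t} \<subseteq> S)))"
      unfolding sum_distrib_left
      by (intro sum.cong refl) (auto simp: of_bool_def)
    also have "\<dots> = int (card (S - T)) * (\<Sum>t\<in>{1..n} - S. of_bool (T - {t} \<subseteq> S))"
    proof -
      have "(\<Sum>s\<in>S. of_bool (s \<notin> T)) = int (card (S - T))"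
        using S'(2) by (simp add: sum.If_cases of_bool_def Diff_eq Compl_eq)
      then show ?thesis by (simp flip: sum_distrib_right)
    qed
    finally have lhs: "A (star T) S = int (card (S - T)) * (\<Sum>t\<in>{1..n} - S. of_bool (T - {t} \<subseteq> S))" .
    have rhs: "(of_int ((3 - int (card T)) * (int n - 3) - int (card T) * (4 - int (card T))) * star T
      + of_int (4 - int (card T)) * (\<Sum>a\<in>T. star (T - {a}))) S =
      ((3 - int (card T)) * (int n - 3) - int (card T) * (4 - int (card T))) * of_bool (T \<subseteq> S)
      + (4 - int (card T)) * (\<Sum>a\<in>T. of_bool (T - {a} \<subseteq> S))"
      using S by (simp only: plus_fun_apply times_fun_apply of_int_fun_apply sum_fun_apply star_def)
        simp
    show ?thesis
    proof (cases "T \<subseteq> S")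
      case True
      have "card (S - T) = 3 - card T" "card T \<le> 3"
        using True S' card_mono[OF S'(2) True] by (simp_all add: card_Diff_subset finT)
      then have c: "int (card (S - T)) = 3 - int (card T)" by simp
      have "card ({1..n} - S) = n - 3" using S' by (simp add: card_Diff_subset)
      then have c1: "(\<Sum>t\<in>{1..n} - S. of_bool (T - {t} \<subseteq> S)) = int n - 3"
        using True n m l5 by (simp add: subset_iff)
      have c2: "(\<Sum>a\<in>T. of_bool (T - {a} \<subseteq> S)) = int (card T)"
        using True by (simp add: subset_iff)
      show ?thesis unfolding lhs rhs c c1 c2 using True by (simp add: algebra_simps)
    next
      case False
      define q where "q = (\<Sum>t\<in>T. of_bool (T - {t} \<subseteq> S) :: int)"
      have "q = (\<Sum>t\<in>T - S. of_bool (T - {t} \<subseteq> S))" unfolding q_def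
        using False finT by (intro sum.mono_neutral_right) auto
      also have "\<dots> = (\<Sum>t\<in>{1..n} - S. of_bool (T - {t} \<subseteq> S))"
        using False T by (intro sum.mono_neutral_left) auto
      finally have q: "(\<Sum>t\<in>{1..n} - S. of_bool (T - {t} \<subseteq> S)) = q" by simp
      have "int (card (S - T)) * q = (4 - int (card T)) * q"
      proof (cases "q = 0")
        case False
        then obtain t where t: "t \<in> T" "T - {t} \<subseteq> S"
          unfolding q_def by (auto elim!: sum.not_neutral_contains_not_neutral)
        with \<open>\<not> T \<subseteq> S\<close> have "S - T = S - (T - {t})" by auto
        then have "card (S - T) = 3 - (card T - 1)"
          using t S' finT by (simp add: card_Diff_subset)
        moreover have "card (T - {t}) \<le> 3" using card_mono[OF S'(2) t(2)] S'(3) by simp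
        ultimately show ?thesis using t finT by (cases "card T") (auto simp: of_nat_diff)
      qed simp
      then show ?thesis unfolding lhs rhs q using False by (simp add: q_def)
    qed
  qed
qed

lemma A_empty: "A (star {}) = of_int (3 * (int n - 3)) * star {}"
  using A_star[of "{}"] by simp

lemma A_single:
  assumes "a \<in> {1..n}"
  shows "A (star {a}) = of_int (2 * int n - 9) * star {a} + 3 * star {}"
  using A_star[of "{a}"] assms by (simp add: algebra_simps)

lemma A_pair:
  assumes "a \<in> {1..n}" "b \<in> {1..n}" "a \<noteq> b"
  shows "A (star {a, b}) = of_int (int n - 7) * star {a, b} + 2 * (star {a} + star {b})"
  using A_star[of "{a, b}"] assms by (simp add: insert_Diff_if algebra_simps)

lemma A_triple:
  assumes "a \<in> {1..n}" "b \<in> {1..n}" "c \<in> {1..n}" "a \<noteq> b" "a \<noteq> c" "b \<noteq> c"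
  shows "A (star {a, b, c}) = star {a, b} + star {a, c} + star {b, c} - 3 * star {a, b, c}"
  using A_star[of "{a, b, c}"] assms by (simp add: insert_Diff_if algebra_simps insert_commute)

lemma sum_star:
  assumes T: "T \<subseteq> {1..n}" "card T \<le> 3"
  shows "(\<Sum>b\<in>{1..n} - T. star (insert b T)) = of_nat (3 - card T) * star T"
proof
  fix S
  have "(\<Sum>b\<in>{1..n} - T. of_bool (insert b T \<subseteq> S)) = int (3 - card T)"
    if S: "S \<in> johnson_verts n 3" "T \<subseteq> S"
  proof -
    note S' = vertsD[OF S(1)]
    have "(\<Sum>b\<in>{1..n} - T. of_bool (insert b T \<subseteq> S)) = (\<Sum>b\<in>S - T. 1::int)"
      using S S' by (intro sum.mono_neutral_cong_right) auto
    also have "\<dots> = int (3 - card T)"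
      using S S' finite_subset[OF S(2)] by (simp add: card_Diff_subset)
    finally show ?thesis .
  qed
  then show "(\<Sum>b\<in>{1..n} - T. star (insert b T)) S = (of_nat (3 - card T) * star T) S"
    by (cases "S \<in> johnson_verts n 3 \<and> T \<subseteq> S") (auto simp: sum_fun_apply star_def)
qed

lemma sum_triples:
  assumes "F \<subseteq> johnson_verts n 3"
  shows "(\<Sum>S\<in>F. star S) = (\<lambda>S. of_bool (S \<in> F))"
proof
  fix S
  have fin: "finite F" using assms finite_subset[of F "Pow {1..n}"] by (auto simp: johnson_verts_def)
  have "(\<Sum>T\<in>F. star T) S = (\<Sum>T\<in>F. of_bool (T = S))"
    unfolding sum_fun_apply
  proof (rule sum.cong[OF refl])
    fix T assume "T \<in> F"
    then have T: "T \<in> johnson_verts n 3" using assms by auto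
    have "T = S" if "S \<in> johnson_verts n 3" "T \<subseteq> S"
      using card_subset_eq[of S T] that vertsD[OF T] vertsD[OF that(1)] by simp
    then show "star T S = of_bool (T = S)" using T by (auto simp: star_def)
  qed
  also have "\<dots> = of_bool (S \<in> F)" using fin by (simp add: of_bool_def)
  finally show "(\<Sum>S\<in>F. star S) S = of_bool (S \<in> F)" .
qed

text \<open>A triple S meets {1..m} in k = 3 or k = 2 points, and k choose 2 equals 2 k - 3 for both values. This relation
  is what makes the stars of one pair redundant in the lattice spanned by the stars of small sets.\<close>

lemma sum_pairs:
  "(\<Sum>p | p \<subseteq> {1..m} \<and> card p = 2. star p) = 2 * (\<Sum>a\<in>{1..m}. star {a}) - 3 * star {}"
proof
  fix S
  have fin: "finite {p. p \<subseteq> {1..m} \<and> card p = 2}" by (rule finite_subset[of _ "Pow {1..m}"]) auto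
  show "(\<Sum>p | p \<subseteq> {1..m} \<and> card p = 2. star p) S = (2 * (\<Sum>a\<in>{1..m}. star {a}) - 3 * star {}) S"
  proof (cases "S \<in> johnson_verts n 3")
    case True
    note S' = vertsD[OF True]
    have m_set: "{1..m} = {1..n} - {n}" using n by auto
    have "(\<Sum>p | p \<subseteq> {1..m} \<and> card p = 2. star p) S = int (card {p. p \<subseteq> S - {n} \<and> card p = 2})"
    proof -
      have "{p. p \<subseteq> {1..m} \<and> card p = 2} \<inter> {p. p \<subseteq> S} = {p. p \<subseteq> S - {n} \<and> card p = 2}"
        using m_set S' by blast
      then show ?thesis using True fin
        by (simp add: sum_fun_apply star_def sum_of_bool_eq)
    qed
    also have "\<dots> = int (card (S - {n}) choose 2)" using S' by (simp add: n_subsets)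
    also have "\<dots> = 2 * int (card (S - {n})) - 3"
      using S' by (cases "n \<in> S") (simp_all add: choose_two)
    also have "\<dots> = (2 * (\<Sum>a\<in>{1..m}. star {a}) - 3 * star {}) S"
    proof -
      have "{1..m} \<inter> S = S - {n}" using m_set S' by blast
      then have "(\<Sum>a\<in>{1..m}. star {a}) S = int (card (S - {n}))"
        using True by (simp add: sum_fun_apply star_def sum_of_bool_eq)
      then show ?thesis using True by (simp add: star_def)
    qed
    finally show ?thesis .
  qed (simp add: sum_fun_apply star_def)
qed

section \<open>A basis of the triple lattice\<close>

text \<open>The vectors z, v a and y p correspond to integer combinations of pairs, that is, to weighted graphs. The
  image of such a combination under the map that sends a pair to the sum of its points controls A:
  it is 2 * {1} for z, {a} - {1} for v a, and 0 for y p, which therefore is an eigenvector.\<close>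

definition z :: "nat set \<Rightarrow> int" where
  "z = star {1, 2} + star {1, 3} - star {2, 3}"

definition v :: "nat \<Rightarrow> nat set \<Rightarrow> int" where
  "v a = star {1, a} - z"

definition u :: "nat \<Rightarrow> nat set \<Rightarrow> int" where
  "u a = star {a} - star {1}"

definition y :: "nat set \<Rightarrow> nat set \<Rightarrow> int" where
  "y p = star p - (\<Sum>a\<in>p. star {1, a}) + z"

text \<open>The combinations of pairs from {1..m} with point sum 0 have a basis indexed by the pairs outside the graph
  with edges {1, a} and {2, 3}; this graph is spanning and has a single cycle, of odd length. The pair
  {4, 5} is left out because of the relation in lemma \<open>sum_pairs\<close>.\<close>

definition cycle_pairs :: "nat set set" where
  "cycle_pairs = {p. p \<subseteq> {2..m} \<and> card p = 2} - {{2, 3}, {4, 5}}"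

definition low_basis :: "(nat set \<Rightarrow> int) set" where
  "low_basis = y ` cycle_pairs \<union> v ` {2..m} \<union> u ` {2..m} \<union> {z, star {1}, star {}}"

text \<open>The triples of {1..m} spanning a complement of N are those that remain after using the relations
  given by the stars of single points and of the empty set. These have rank m and can be solved for the triple
  {1, 2, 3} and for the l triples h with m added, where h runs over the edges of a spanning
  graph on {1..l} with one odd cycle. The graph below is the triangle 1, 2, 3 with the
  edge {1, 4} and all other points attached to 2. Its complement in the complete graph is
  connected and not bipartite, which is needed for lemma \<open>cong_m\<close>.\<close>

definition tied_pairs :: "nat set set" where
  "tied_pairs = {{1, 2}, {1, 3}, {2, 3}, {1, 4}} \<union> (\<lambda>a. {2, a}) ` {5..l}"

definition free_triples :: "nat set set" where
  "free_triples = {S. S \<subseteq> {1..m} \<and> card S = 3} - insert {1, 2, 3} (insert m ` tied_pairs)"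

lemma y_pair: "a \<noteq> b \<Longrightarrow> y {a, b} = star {a, b} - star {1, a} - star {1, b} + z"
  by (simp add: y_def algebra_simps)

lemma pairE:
  assumes "p \<subseteq> B" "card p = 2"
  obtains a b where "p = {a, b}" "a \<noteq> b" "a \<in> B" "b \<in> B"
  using assms by (auto simp: card_2_iff)

lemma y_23: "y {2, 3} = 0"
  by (simp add: y_pair z_def)

lemma A_z: "A z = of_int (int n - 7) * z + 4 * star {1}"
proof -
  interpret A: Modules.module_hom "\<lambda>c x. of_int c * x" "\<lambda>c x. of_int c * x" A by (rule A_linear)
  show ?thesis
    using bounds by (simp add: z_def A.add A.diff A_pair ring_distribs)
qed

lemma A_v: "a \<in> {2..m} \<Longrightarrow> A (v a) = of_int (int n - 7) * v a + 2 * u a"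
proof -
  interpret A: Modules.module_hom "\<lambda>c x. of_int c * x" "\<lambda>c x. of_int c * x" A by (rule A_linear)
  show "a \<in> {2..m} \<Longrightarrow> ?thesis"
    using bounds by (simp add: v_def u_def A.diff A_pair A_z ring_distribs)
qed

lemma A_u: "a \<in> {2..m} \<Longrightarrow> A (u a) = of_int (2 * int n - 9) * u a"
proof -
  interpret A: Modules.module_hom "\<lambda>c x. of_int c * x" "\<lambda>c x. of_int c * x" A by (rule A_linear)
  show "a \<in> {2..m} \<Longrightarrow> ?thesis"
    using bounds by (simp add: u_def A.diff A_single ring_distribs)
qed

lemma A_y: "p \<subseteq> {2..m} \<Longrightarrow> card p = 2 \<Longrightarrow> A (y p) = of_int (int n - 7) * y p"
proof (erule (1) pairE)
  fix a b assume *: "p = {a, b}" "a \<noteq> b" "a \<in> {2..m}" "b \<in> {2..m}"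
  interpret A: Modules.module_hom "\<lambda>c x. of_int c * x" "\<lambda>c x. of_int c * x" A by (rule A_linear)
  have "y p = star {a, b} - star {1, a} - star {1, b} + z" using * by (simp add: y_pair)
  then show ?thesis
    using bounds * by (simp add: A.diff A.add A_pair A_z ring_distribs)
qed

text \<open>Used to solve a relation whose total is known for the few terms that are not yet known.\<close>

lemma in_span_isolate:
  assumes fin: "finite F" and E: "E \<subseteq> F"
    and total: "(\<Sum>S\<in>F. g S) \<in> int_span.span B"
    and rest: "\<And>S. S \<in> F \<Longrightarrow> S \<notin> E \<Longrightarrow> g S \<in> int_span.span B"
  shows "(\<Sum>S\<in>E. g S) \<in> int_span.span B"
proof -
  have "(\<Sum>S\<in>E. g S) = (\<Sum>S\<in>F. g S) - (\<Sum>S\<in>F - E. g S)"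
    using sum.subset_diff[OF E fin, of g] by simp
  then show ?thesis
    using total rest by (auto intro!: int_span.span_diff int_span.span_sum)
qed

lemma z_in_low: "z \<in> int_span.span low_basis"
  and star_1_in_low: "star {1} \<in> int_span.span low_basis"
  and star_empty_in_low: "star {} \<in> int_span.span low_basis"
  and u_in_low: "a \<in> {2..m} \<Longrightarrow> u a \<in> int_span.span low_basis"
  by (auto simp: low_basis_def intro!: int_span.span_base)

text \<open>The part of the basis of N that has to be hit by A + 3.\<close>

definition target_basis :: "(nat set \<Rightarrow> int) set" where
  "target_basis = y ` cycle_pairs \<union> v ` {2..m}"

lemma target_basis_subset_low: "int_span.span target_basis \<subseteq> int_span.span low_basis"
  by (intro int_span.span_mono) (auto simp: target_basis_def low_basis_def)

text \<open>Modulo the vectors y and v all pairs become equal to z, except {4, 5}, whose own y is not among the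
  basis vectors.\<close>

lemma star_pair_mod_target:
  assumes p: "p \<subseteq> {1..m}" "card p = 2"
  shows "star p - z - of_bool (p = {4, 5}) * y {4, 5} \<in> int_span.span target_basis"
proof -
  have v: "v a \<in> int_span.span target_basis" if "a \<in> {2..m}" for a
    using that by (auto simp: target_basis_def intro: int_span.span_base)
  have yT: "y q \<in> int_span.span target_basis" if "q \<in> cycle_pairs" for q
    using that by (auto simp: target_basis_def intro: int_span.span_base)
  obtain a b where ab: "p = {a, b}" "a \<noteq> b" "a \<in> {1..m}" "b \<in> {1..m}"
    using p by (rule pairE)
  show ?thesis
  proof (cases "1 \<in> p")
    case True
    then have "p = {1, b} \<and> b \<in> {2..m} \<or> p = {1, a} \<and> a \<in> {2..m}"
      using ab by auto
    then obtain c where "p = {1, c}" "c \<in> {2..m}" by blast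
    then show ?thesis using v[of c] by (auto simp: v_def doubleton_eq_iff)
  next
    case False
    then have ab': "a \<in> {2..m}" "b \<in> {2..m}" using ab by auto
    have eq: "star p - z - of_bool (p = {4, 5}) * y {4, 5} = y p - of_bool (p = {4, 5}) * y {4, 5} + v a + v b"
      using ab by (simp add: y_pair v_def)
    have "y p - of_bool (p = {4, 5}) * y {4, 5} \<in> int_span.span target_basis"
    proof -
      consider "p = {4, 5}" | "p = {2, 3}" "p \<noteq> {4, 5}" | "p \<in> cycle_pairs" "p \<noteq> {4, 5}"
        using ab ab' p(2) by (auto simp: cycle_pairs_def)
      then show ?thesis
        by cases (use yT[of p] y_23 int_span.span_zero in simp_all)
    qed
    then show ?thesis unfolding eq by (intro int_span.span_add v ab')
  qed
qed

text \<open>Pairs inside {1..m} come from the definitions of z, v and y, with {4, 5} recovered from the relation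
  \<open>sum_pairs\<close>. The point n is eliminated by the stars of {a} and of the empty set.\<close>

lemma star_in_low:
  assumes T: "T \<subseteq> {1..n}" "card T \<le> 2"
  shows "star T \<in> int_span.span low_basis"
proof -
  note span = int_span.span_add int_span.span_diff int_span.span_scale int_span.span_base
  have single: "star {a} \<in> int_span.span low_basis" if "a \<in> {1..m}" for a
  proof (cases "a = 1")
    case False
    then have "u a + star {1} \<in> int_span.span low_basis"
      using that by (intro int_span.span_add u_in_low star_1_in_low) auto
    then show ?thesis by (simp add: u_def)
  qed (use star_1_in_low in simp)
  have pair: "star p \<in> int_span.span low_basis" if p: "p \<subseteq> {1..m}" "card p = 2" for p
  proof -
    have generic: "star q \<in> int_span.span low_basis" if "q \<subseteq> {1..m}" "card q = 2" "q \<noteq> {4, 5}" for q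
    proof -
      have "star q - z \<in> int_span.span low_basis"
        using star_pair_mod_target[OF that(1,2)] that(3) target_basis_subset_low by auto
      from int_span.span_add[OF this z_in_low] show ?thesis by simp
    qed
    let ?F = "{p. p \<subseteq> {1..m} \<and> card p = 2}"
    have "(\<Sum>q\<in>{{4, 5}}. star q) \<in> int_span.span low_basis"
    proof (rule in_span_isolate[of ?F])
      show "finite ?F" by (rule finite_subset[of _ "Pow {1..m}"]) auto
      show "{{4, 5}} \<subseteq> ?F" using bounds by auto
      have "2 * (\<Sum>a\<in>{1..m}. star {a}) - 3 * star {} \<in> int_span.span low_basis"
        using int_span.span_diff[OF int_span.span_scale[OF int_span.span_sum, of "{1..m}" "\<lambda>a. star {a}" low_basis 2]
            int_span.span_scale[OF star_empty_in_low, of 3]] single by simp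
      then show "(\<Sum>p\<in>?F. star p) \<in> int_span.span low_basis" by (simp only: sum_pairs)
    qed (use generic in auto)
    then show ?thesis using generic[OF p] by (cases "p = {4, 5}") auto
  qed
  have pair_n: "star {a, n} \<in> int_span.span low_basis" if a: "a \<in> {1..m}" for a
  proof -
    have "(\<Sum>b\<in>{1..n} - {a}. star (insert b {a})) = of_int 2 * star {a}"
      using a bounds sum_star[of "{a}"] by simp
    then have "(\<Sum>b\<in>{1..n} - {a}. star (insert b {a})) \<in> int_span.span low_basis"
      using int_span.span_scale[OF single[OF a], of 2] by simp
    then have "(\<Sum>b\<in>{n}. star (insert b {a})) \<in> int_span.span low_basis"
    proof (rule in_span_isolate[rotated 2])
      fix b assume "b \<in> {1..n} - {a}" "b \<notin> {n}"
      then show "star (insert b {a}) \<in> int_span.span low_basis"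
        using a bounds by (intro pair) (auto simp: le_n_iff)
    qed (use a bounds in auto)
    then show ?thesis by (simp add: insert_commute)
  qed
  have single_n: "star {n} \<in> int_span.span low_basis"
  proof -
    have "(\<Sum>b\<in>{1..n} - {}. star (insert b {})) = of_int 3 * star {}"
      using sum_star[of "{}"] by simp
    then have "(\<Sum>b\<in>{1..n} - {}. star (insert b {})) \<in> int_span.span low_basis"
      using int_span.span_scale[OF star_empty_in_low, of 3] by simp
    then have "(\<Sum>b\<in>{n}. star (insert b {})) \<in> int_span.span low_basis"
      by (rule in_span_isolate[rotated 2]) (use bounds single le_n_iff in auto)
    then show ?thesis by simp
  qed
  have single': "star {a} \<in> int_span.span low_basis" if "a \<in> {1..n}" for a
    using that single single_n by (cases "a = n") (auto simp: le_n_iff)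
  have pair': "star {a, b} \<in> int_span.span low_basis" if "a \<in> {1..n}" "b \<in> {1..n}" "a \<noteq> b" for a b
  proof -
    have "a \<in> {1..m} \<or> a = n" "b \<in> {1..m} \<or> b = n" using that by (auto simp: le_n_iff)
    then consider "a = n" | "b = n" | "a \<in> {1..m}" "b \<in> {1..m}" by blast
    then show ?thesis
    proof cases
      case 1
      then have "b \<in> {1..m}" using that \<open>b \<in> {1..m} \<or> b = n\<close> by blast
      then show ?thesis using pair_n[of b] 1 by (simp add: insert_commute)
    next
      case 2
      then have "a \<in> {1..m}" using that \<open>a \<in> {1..m} \<or> a = n\<close> by blast
      then show ?thesis using pair_n[of a] 2 by simp
    next
      case 3
      then show ?thesis using that pair[of "{a, b}"] by auto
    qed
  qed
  have "finite T" using T finite_subset by blast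
  consider "card T = 0" | "card T = 1" | "card T = 2" using T(2) by linarith
  then show ?thesis
  proof cases
    case 1
    then show ?thesis using star_empty_in_low \<open>finite T\<close> by simp
  next
    case 2
    then show ?thesis using T(1) single' by (auto simp: card_1_singleton_iff)
  next
    case 3
    then show ?thesis using T(1) pair' by (auto simp: card_2_iff)
  qed
qed

text \<open>Modulo N the sum of the triples of {1..m} through a point a vanishes, and so does the sum of all triples of {1..l}.
  The latter yields {1, 2, 3}. The star of a point a at m then yields its tied triple when a is at least 4, and for
  a = 1, 2, together with the sum over all triples through m, it yields the triangle 1, 2, 3 joined with m.
  A triple containing n is finally expressed by the star of its other two points.\<close>

lemma star_in_low_free_span:
  assumes T: "T \<subseteq> {1..n}" "card T = 3"
  shows "star T \<in> int_span.span (low_basis \<union> star ` free_triples)"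
proof -
  define G where "G = int_span.span (low_basis \<union> star ` free_triples)"
  define F where "F P = {S. S \<subseteq> {1..m} \<and> card S = 3 \<and> P S}" for P
  have NG: "star T \<in> G" if "T \<subseteq> {1..n}" "card T \<le> 2" for T
    using star_in_low[OF that] int_span.span_mono[of low_basis "low_basis \<union> star ` free_triples"] by (auto simp: G_def)
  have RG: "star S \<in> G" if "S \<in> free_triples" for S
    using that by (auto simp: G_def intro: int_span.span_base)
  have m_set: "{1..m} = {1..n} - {n}" using bounds by (auto simp: le_n_iff)
  have l_set: "{1..l} = {1..m} - {m}" using bounds by (auto simp: le_m_iff)
  have F_iff: "S \<in> F P \<longleftrightarrow> S \<in> johnson_verts n 3 \<and> n \<notin> S \<and> P S" for S P
    unfolding F_def johnson_verts_def m_set by auto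
  have F_verts: "F P \<subseteq> johnson_verts n 3" for P
    by (auto simp: F_iff)
  have finF: "finite (F P)" for P
    by (rule finite_subset[of _ "Pow {1..m}"]) (auto simp: F_def)
  have isolate: "(\<Sum>S\<in>E. star S) \<in> G"
    if "(\<Sum>S\<in>F P. star S) \<in> G" "E \<subseteq> F P" "\<And>S. S \<in> F P \<Longrightarrow> S \<notin> E \<Longrightarrow> star S \<in> G" for E P
    using in_span_isolate[OF finF that(2), of star] that(1,3) unfolding G_def by blast
  have link: "(\<Sum>S\<in>F (\<lambda>S. a \<in> S). star S) \<in> G" if a: "a \<in> {1..m}" for a
  proof -
    have "(\<Sum>S\<in>F (\<lambda>S. a \<in> S). star S) = star {a} - star {a, n}"
      unfolding sum_triples[OF F_verts]
      by (auto simp: fun_eq_iff F_iff star_def)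
    also have "\<dots> \<in> G"
      using NG[of "{a}"] NG[of "{a, n}"] a bounds by (auto simp: G_def intro!: int_span.span_diff)
    finally show ?thesis .
  qed
  have low: "star S \<in> G" if S: "S \<subseteq> {1..l}" "card S = 3" for S
  proof -
    have notEX: "S \<notin> insert m ` tied_pairs" if "S \<subseteq> {1..l}" for S using that bounds by auto
    have "(\<Sum>S\<in>F (\<lambda>S. m \<notin> S). star S) = star {} - star {n} - (star {m} - star {m, n})"
      unfolding sum_triples[OF F_verts]
      by (auto simp: fun_eq_iff F_iff star_def)
    also have "\<dots> \<in> G"
      using NG[of "{}"] NG[of "{n}"] NG[of "{m}"] NG[of "{m, n}"] bounds
      by (auto simp: G_def intro!: int_span.span_diff)
    finally have "(\<Sum>S\<in>F (\<lambda>S. m \<notin> S). star S) \<in> G" .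
    then have "(\<Sum>S\<in>{{1, 2, 3}}. star S) \<in> G"
    proof (rule isolate)
      fix S assume S: "S \<in> F (\<lambda>S. m \<notin> S)" "S \<notin> {{1, 2, 3}}"
      then have "S \<in> free_triples" by (auto simp: F_def free_triples_def)
      then show "star S \<in> G" by (rule RG)
    qed (use bounds in \<open>auto simp: F_def\<close>)
    moreover have "S \<in> free_triples" if "S \<noteq> {1, 2, 3}"
    proof -
      have "S \<subseteq> {1..m}" using S l_set by blast
      then show ?thesis using that S(2) notEX[OF S(1)] unfolding free_triples_def by blast
    qed
    ultimately show ?thesis using RG by (cases "S = {1, 2, 3}") auto
  qed
  have link_m: "(\<Sum>S\<in>F (\<lambda>S. a \<in> S \<and> m \<in> S). star S) \<in> G" if a: "a \<in> {1..l}" for a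
  proof -
    have "(\<Sum>S\<in>F (\<lambda>S. a \<in> S \<and> m \<in> S). star S) =
        (\<Sum>S\<in>F (\<lambda>S. a \<in> S). star S) - (\<Sum>S\<in>F (\<lambda>S. a \<in> S \<and> m \<notin> S). star S)"
      unfolding sum_triples[OF F_verts] by (auto simp: fun_eq_iff F_def)
    moreover have "(\<Sum>S\<in>F (\<lambda>S. a \<in> S \<and> m \<notin> S). star S) \<in> G"
      unfolding G_def
    proof (rule int_span.span_sum)
      fix S assume "S \<in> F (\<lambda>S. a \<in> S \<and> m \<notin> S)"
      then show "star S \<in> int_span.span (low_basis \<union> star ` free_triples)"
        using low[of S] unfolding l_set by (auto simp: F_def G_def)
    qed
    ultimately show ?thesis using link[of a] a bounds by (auto simp: G_def intro: int_span.span_diff)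
  qed
  have EX: "\<exists>h\<in>tied_pairs. S = insert m h" if "S \<in> F P" "m \<in> S" "star S \<notin> G" for S P
  proof -
    have "S \<notin> free_triples" "S \<subseteq> {1..m}" "card S = 3" using that RG[of S] by (auto simp: F_def)
    moreover have "S \<noteq> {1, 2, 3}" using that(2) bounds by auto
    ultimately show ?thesis unfolding free_triples_def by blast
  qed
  have ge5: "star {2, a, m} \<in> G" if a: "a \<in> {5..l}" for a
  proof -
    have "(\<Sum>S\<in>{{2, a, m}}. star S) \<in> G"
    proof (rule isolate[OF link_m])
      show "a \<in> {1..l}" using a by simp
      show "{{2, a, m}} \<subseteq> F (\<lambda>S. a \<in> S \<and> m \<in> S)" using a bounds by (auto simp: F_def)
      fix S assume S: "S \<in> F (\<lambda>S. a \<in> S \<and> m \<in> S)" "S \<notin> {{2, a, m}}"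
      show "star S \<in> G"
      proof (rule ccontr)
        assume "star S \<notin> G"
        then obtain h where "h \<in> tied_pairs" "S = insert m h" using EX[OF S(1)] S by (auto simp: F_def)
        then show False using S a bounds by (auto simp: tied_pairs_def F_def)
      qed
    qed
    then show ?thesis by simp
  qed
  have X14: "star {1, 4, m} \<in> G"
  proof -
    have "(\<Sum>S\<in>{{1, 4, m}}. star S) \<in> G"
    proof (rule isolate[OF link_m])
      show "4 \<in> {1..l}" using bounds by simp
      show "{{1, 4, m}} \<subseteq> F (\<lambda>S. 4 \<in> S \<and> m \<in> S)" using bounds by (auto simp: F_def)
      fix S assume S: "S \<in> F (\<lambda>S. 4 \<in> S \<and> m \<in> S)" "S \<notin> {{1, 4, m}}"
      show "star S \<in> G"
      proof (rule ccontr)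
        assume "star S \<notin> G"
        then obtain h where "h \<in> tied_pairs" "S = insert m h" using EX[OF S(1)] S by (auto simp: F_def)
        then show False using S bounds by (auto simp: tied_pairs_def F_def)
      qed
    qed
    then show ?thesis by simp
  qed
  have tri: "S = {1, 2, m} \<or> S = {1, 3, m} \<or> S = {2, 3, m}" if S: "S \<in> F P" "m \<in> S" "star S \<notin> G" for S P
  proof -
    obtain h where h: "h \<in> tied_pairs" "S = insert m h" using EX[OF S] by blast
    have perm: "insert m {a, b} = {a, b, m}" for a b by auto
    have "h \<noteq> {1, 4}" "\<And>a. a \<in> {5..l} \<Longrightarrow> h \<noteq> {2, a}"
      using h(2) S(3) ge5 X14 by (metis perm)+
    then have "h = {1, 2} \<or> h = {1, 3} \<or> h = {2, 3}" using h(1) unfolding tied_pairs_def by blast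
    then show ?thesis using h(2) perm[of 1 2] perm[of 1 3] perm[of 2 3] by blast
  qed
  have nin: "2 \<notin> {1, 3, m}" "1 \<notin> {2, 3, m}" using bounds by auto
  have ne: "{1, 2, m} \<noteq> {1, 3, m}" "{1, 2, m} \<noteq> {2, 3, m}" "{1, 3, m} \<noteq> {2, 3, m}"
    using nin by blast+
  have s1: "star {1, 2, m} + star {1, 3, m} \<in> G"
  proof -
    have "(\<Sum>S\<in>{{1, 2, m}, {1, 3, m}}. star S) \<in> G"
    proof (rule isolate[OF link_m])
      show "1 \<in> {1..l}" using bounds by simp
      show "{{1, 2, m}, {1, 3, m}} \<subseteq> F (\<lambda>S. 1 \<in> S \<and> m \<in> S)" using bounds by (auto simp: F_def)
      fix S assume S: "S \<in> F (\<lambda>S. 1 \<in> S \<and> m \<in> S)" "S \<notin> {{1, 2, m}, {1, 3, m}}"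
      then have "m \<in> S" "1 \<in> S" by (auto simp: F_def)
      then show "star S \<in> G" using tri[OF S(1)] S(2) nin by blast
    qed
    then show ?thesis using ne by simp
  qed
  have s2: "star {1, 2, m} + star {2, 3, m} \<in> G"
  proof -
    have "(\<Sum>S\<in>{{1, 2, m}, {2, 3, m}}. star S) \<in> G"
    proof (rule isolate[OF link_m])
      show "2 \<in> {1..l}" using bounds by simp
      show "{{1, 2, m}, {2, 3, m}} \<subseteq> F (\<lambda>S. 2 \<in> S \<and> m \<in> S)" using bounds by (auto simp: F_def)
      fix S assume S: "S \<in> F (\<lambda>S. 2 \<in> S \<and> m \<in> S)" "S \<notin> {{1, 2, m}, {2, 3, m}}"
      then have "m \<in> S" "2 \<in> S" by (auto simp: F_def)
      then show "star S \<in> G" using tri[OF S(1)] S(2) nin by blast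
    qed
    then show ?thesis using ne by simp
  qed
  have s3: "star {1, 2, m} + star {1, 3, m} + star {2, 3, m} \<in> G"
  proof -
    have "(\<Sum>S\<in>{{1, 2, m}, {1, 3, m}, {2, 3, m}}. star S) \<in> G"
    proof (rule isolate[OF link])
      show "m \<in> {1..m}" using bounds by simp
      show "{{1, 2, m}, {1, 3, m}, {2, 3, m}} \<subseteq> F (\<lambda>S. m \<in> S)" using bounds by (auto simp: F_def)
      fix S assume S: "S \<in> F (\<lambda>S. m \<in> S)" "S \<notin> {{1, 2, m}, {1, 3, m}, {2, 3, m}}"
      then have "m \<in> S" by (auto simp: F_def)
      then show "star S \<in> G" using tri[OF S(1)] S(2) nin by blast
    qed
    then show ?thesis using ne by (simp add: add.assoc)
  qed
  have X23: "star {2, 3, m} \<in> G"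
    using int_span.span_diff[of _ "low_basis \<union> star ` free_triples", OF s3[unfolded G_def] s1[unfolded G_def]] by (simp add: G_def)
  have X13: "star {1, 3, m} \<in> G"
    using int_span.span_diff[of _ "low_basis \<union> star ` free_triples", OF s3[unfolded G_def] s2[unfolded G_def]]
    by (simp add: G_def algebra_simps)
  have X12: "star {1, 2, m} \<in> G"
    using int_span.span_diff[of _ "low_basis \<union> star ` free_triples", OF s2[unfolded G_def] X23[unfolded G_def]] by (simp add: G_def)
  have mid: "star S \<in> G" if S: "S \<subseteq> {1..m}" "card S = 3" for S
  proof (rule ccontr)
    assume *: "star S \<notin> G"
    have SF: "S \<in> F (\<lambda>_. True)" using S by (simp add: F_def)
    show False
    proof (cases "m \<in> S")
      case True
      then show False using tri[OF SF True *] * X12 X13 X23 by blast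
    next
      case False
      then have "S \<subseteq> {1..l}" using S unfolding l_set by auto
      then show False using low S(2) * by blast
    qed
  qed
  have "star T \<in> G"
  proof (cases "n \<in> T")
    case False
    then have "T \<subseteq> {1..m}" using T unfolding m_set by auto
    then show ?thesis using mid T by blast
  next
    case True
    define p where "p = T - {n}"
    have finT: "finite T" using T finite_subset by blast
    have p: "p \<subseteq> {1..m}" "card p = 2" "n \<notin> p" "finite p"
      using True T finT unfolding m_set by (auto simp: p_def)
    have "(\<Sum>b\<in>{1..n} - p. star (insert b p)) = star p"
      using p bounds sum_star[of p] subset_trans[OF p(1), of "{1..n}"] by simp
    also have "\<dots> \<in> G" using p bounds by (intro NG) auto
    finally have "(\<Sum>b\<in>{1..n} - p. star (insert b p)) \<in> int_span.span (low_basis \<union> star ` free_triples)" by (simp add: G_def)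
    then have "(\<Sum>b\<in>{n}. star (insert b p)) \<in> int_span.span (low_basis \<union> star ` free_triples)"
    proof (rule in_span_isolate[rotated 2])
      fix b assume b: "b \<in> {1..n} - p" "b \<notin> {n}"
      then show "star (insert b p) \<in> int_span.span (low_basis \<union> star ` free_triples)"
        using mid[of "insert b p"] p bounds by (auto simp: G_def le_n_iff)
    qed (use p bounds in auto)
    moreover have "insert n p = T" using True by (auto simp: p_def)
    ultimately show ?thesis by (simp add: G_def)
  qed
  then show ?thesis by (simp add: G_def)
qed

section \<open>The operator A + 3 modulo 3\<close>

text \<open>The name recalls that A + 3 is the Gram matrix of the inclusion matrix of pairs versus triples.\<close>

definition gram :: "(nat set \<Rightarrow> int) \<Rightarrow> nat set \<Rightarrow> int" where
  "gram g = A g + 3 * g"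

definition low3 :: "(nat set \<Rightarrow> int) set" where
  "low3 = (\<lambda>g. 3 * g) ` int_span.span low_basis"

lemma gram_linear: "int_linear gram"
proof -
  interpret A: Modules.module_hom "\<lambda>c x. of_int c * x" "\<lambda>c x. of_int c * x" A by (rule A_linear)
  show ?thesis
    by unfold_locales (simp_all add: gram_def A.add A.scale distrib_left mult.left_commute)
qed

lemma gram_triple:
  assumes "a \<in> {1..n}" "b \<in> {1..n}" "c \<in> {1..n}" "a \<noteq> b" "a \<noteq> c" "b \<noteq> c"
  shows "gram (star {a, b, c}) = star {a, b} + star {a, c} + star {b, c}"
  using A_triple[OF assms] by (simp add: gram_def)

lemma low3_subspace: "int_span.subspace low3"
  unfolding low3_def
proof (rule int_span.subspaceI)
  show "0 \<in> (\<lambda>g. 3 * g) ` int_span.span low_basis"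
    by (rule image_eqI[of _ _ 0]) (simp_all add: int_span.span_zero)
  fix g h assume "g \<in> (\<lambda>g. 3 * g) ` int_span.span low_basis" "h \<in> (\<lambda>g. 3 * g) ` int_span.span low_basis"
  then obtain g' h' where "g = 3 * g'" "h = 3 * h'" "g' \<in> int_span.span low_basis" "h' \<in> int_span.span low_basis" by auto
  then show "g + h \<in> (\<lambda>g. 3 * g) ` int_span.span low_basis"
    by (intro image_eqI[of _ _ "g' + h'"]) (simp_all add: int_span.span_add distrib_left)
next
  fix c g assume "g \<in> (\<lambda>g. 3 * g) ` int_span.span low_basis"
  then obtain g' where "g = 3 * g'" "g' \<in> int_span.span low_basis" by auto
  then show "of_int c * g \<in> (\<lambda>g. 3 * g) ` int_span.span low_basis"
    by (intro image_eqI[of _ _ "of_int c * g'"]) (simp_all add: int_span.span_scale mult.left_commute)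
qed

lemma low3_I: "g \<in> int_span.span low_basis \<Longrightarrow> 3 * g \<in> low3"
  by (auto simp: low3_def)

lemmas low3_sub = int_span.subspace_add[OF low3_subspace] int_span.subspace_diff[OF low3_subspace]
  int_span.subspace_scale[OF low3_subspace] int_span.subspace_0[OF low3_subspace]

lemma free_triples_D:
  assumes "S \<in> free_triples"
  shows "S \<subseteq> {1..m}" "card S = 3" "S \<subseteq> {1..n}"
proof -
  show "S \<subseteq> {1..m}" "card S = 3" using assms by (auto simp: free_triples_def)
  moreover have "{1..m} \<subseteq> {1..n}" using bounds by auto
  ultimately show "S \<subseteq> {1..n}" by blast
qed

lemma card_3_distinct: "card S = 3 \<Longrightarrow> \<exists>a b c. S = {a, b, c} \<and> a \<noteq> b \<and> a \<noteq> c \<and> b \<noteq> c"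
  using card_3_iff[of S] by auto

lemma gram_triple_in_low:
  assumes "S \<subseteq> {1..n}" "card S = 3"
  shows "gram (star S) \<in> int_span.span low_basis"
proof -
  obtain a b c where abc: "S = {a, b, c}" "a \<noteq> b" "a \<noteq> c" "b \<noteq> c"
    using card_3_distinct[OF assms(2)] by blast
  then have "gram (star S) = star {a, b} + star {a, c} + star {b, c}" using gram_triple assms by auto
  then show ?thesis using abc assms by (auto intro!: int_span.span_add star_in_low)
qed

lemma gram_free_in_low: "x \<in> int_span.span (star ` free_triples) \<Longrightarrow> gram x \<in> int_span.span low_basis"
proof -
  interpret gram: Modules.module_hom "\<lambda>c x. of_int c * x" "\<lambda>c x. of_int c * x" gram by (rule gram_linear)
  assume "x \<in> int_span.span (star ` free_triples)"
  then have "gram x \<in> int_span.span (gram ` star ` free_triples)" by (simp add: gram.span_image)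
  also have "\<dots> \<subseteq> int_span.span low_basis"
    by (intro int_span.span_minimal int_span.subspace_span) (auto intro: gram_triple_in_low[OF free_triples_D(3) free_triples_D(2)])
  finally show ?thesis .
qed

text \<open>The values of A + 3 on the complement of N spanned by the free triples, up to 3 N.\<close>

definition covered :: "(nat set \<Rightarrow> int) set" where
  "covered = {g. \<exists>x \<in> int_span.span (star ` free_triples). gram x - g \<in> low3}"

lemma covered_subspace: "int_span.subspace covered"
proof -
  interpret gram: Modules.module_hom "\<lambda>c x. of_int c * x" "\<lambda>c x. of_int c * x" gram by (rule gram_linear)
  show ?thesis
  proof (rule int_span.subspaceI)
    show "0 \<in> covered" unfolding covered_def
      using int_span.span_zero[of "star ` free_triples"] gram.zero low3_sub(4) by force
    fix g h assume "g \<in> covered" "h \<in> covered"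
    then obtain g' h' where gh: "g' \<in> int_span.span (star ` free_triples)" "h' \<in> int_span.span (star ` free_triples)"
       "gram g' - g \<in> low3" "gram h' - h \<in> low3" unfolding covered_def by auto
    have "gram (g' + h') - (g + h) = (gram g' - g) + (gram h' - h)" by (simp add: gram.add)
    then have "gram (g' + h') - (g + h) \<in> low3" using low3_sub(1)[OF gh(3,4)] by metis
    then show "g + h \<in> covered" unfolding covered_def using int_span.span_add gh by blast
  next
    fix c g assume "g \<in> covered"
    then obtain g' where g: "g' \<in> int_span.span (star ` free_triples)" "gram g' - g \<in> low3" unfolding covered_def by auto
    have "gram (of_int c * g') - of_int c * g = of_int c * (gram g' - g)"
      by (simp add: gram.scale right_diff_distrib)
    then have "gram (of_int c * g') - of_int c * g \<in> low3" using low3_sub(3)[OF g(2)] by metis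
    then show "of_int c * g \<in> covered" unfolding covered_def using int_span.span_scale g by blast
  qed
qed

lemmas covered_add = int_span.subspace_add[OF covered_subspace]
lemmas covered_diff = int_span.subspace_diff[OF covered_subspace]
lemmas covered_0 = int_span.subspace_0[OF covered_subspace]

lemma covered_three: "g \<in> int_span.span low_basis \<Longrightarrow> 3 * g \<in> covered"
proof -
  interpret gram: Modules.module_hom "\<lambda>c x. of_int c * x" "\<lambda>c x. of_int c * x" gram by (rule gram_linear)
  assume "g \<in> int_span.span low_basis"
  then have "gram 0 - 3 * g \<in> low3" using low3_sub(2)[OF low3_sub(4) low3_I] gram.zero by simp
  then show ?thesis unfolding covered_def using int_span.span_zero by blast
qed

text \<open>Modulo 3 N the number 2 is the unit -1.\<close>

lemma covered_of_double: "2 * g \<in> covered \<Longrightarrow> g \<in> int_span.span low_basis \<Longrightarrow> g \<in> covered"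
  using covered_diff[OF covered_three, of g "2 * g"] by simp

lemma gram_free_in_covered: "S \<in> free_triples \<Longrightarrow> gram (star S) \<in> covered"
proof -
  assume "S \<in> free_triples"
  then have "star S \<in> int_span.span (star ` free_triples)" by (auto intro: int_span.span_base)
  then show ?thesis using low3_sub(4) unfolding covered_def by force
qed

definition triangle :: "nat \<Rightarrow> nat \<Rightarrow> nat \<Rightarrow> nat set \<Rightarrow> int" where
  "triangle a b c = star {a, b} + star {a, c} + star {b, c}"

lemma triangle_in_covered:
  assumes "{a, b, c} \<in> free_triples" "a \<noteq> b" "a \<noteq> c" "b \<noteq> c"
  shows "triangle a b c \<in> covered"
  using gram_free_in_covered[OF assms(1)] free_triples_D(1)[OF assms(1)] assms(2-) gram_triple[of a b c] bounds
  by (simp add: triangle_def le_n_iff)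

lemma low_free_triples:
  assumes "{a, b, c} \<subseteq> {1..l}" "a \<noteq> b" "a \<noteq> c" "b \<noteq> c" "{a, b, c} \<noteq> {1, 2, 3}"
  shows "{a, b, c} \<in> free_triples"
proof -
  have "{a, b, c} \<subseteq> {1..m}" "m \<notin> {a, b, c}" using assms(1) bounds by auto
  then show ?thesis using assms(2-) unfolding free_triples_def by auto
qed

lemma star_pair_in_low: "a \<in> {1..n} \<Longrightarrow> b \<in> {1..n} \<Longrightarrow> star {a, b} \<in> int_span.span low_basis"
  by (rule star_in_low) (auto simp: card_insert_if)

text \<open>The triple {1, 2, 3} is not free. But in the sum over all ten triples of {1..5} every pair occurs three
  times, so modulo 3 its value is minus the sum of the nine others.\<close>

lemma triangle_low:
  assumes "{a, b, c} \<subseteq> {1..l}" "a \<noteq> b" "a \<noteq> c" "b \<noteq> c"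
  shows "triangle a b c \<in> covered"
proof -
  have tri: "triangle a b c \<in> covered" if "{a, b, c} \<subseteq> {1..5}" "a \<noteq> b" "a \<noteq> c" "b \<noteq> c" "{a, b, c} \<noteq> {1, 2, 3}" for a b c
    using that bounds(1) by (intro triangle_in_covered low_free_triples) auto
  let ?s = "star {1, 2} + star {1, 3} + star {1, 4} + star {1, 5} + star {2, 3} + star {2, 4} + star {2, 5} + star {3, 4} + star {3, 5} + star {4, 5}"
  have ne: "{1, 2, 4} \<noteq> {1, 2, 3::nat}" "{1, 2, 5} \<noteq> {1, 2, 3::nat}" "{1, 3, 4} \<noteq> {1, 2, 3::nat}"
    "{1, 3, 5} \<noteq> {1, 2, 3::nat}" "{1, 4, 5} \<noteq> {1, 2, 3::nat}" "{2, 3, 4} \<noteq> {1, 2, 3::nat}"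
    "{2, 3, 5} \<noteq> {1, 2, 3::nat}" "{2, 4, 5} \<noteq> {1, 2, 3::nat}" "{3, 4, 5} \<noteq> {1, 2, 3::nat}"
    by (auto simp: set_eq_iff)
  have "triangle 1 2 3 = 3 * ?s - (triangle 1 2 4 + triangle 1 2 5 + triangle 1 3 4 + triangle 1 3 5 + triangle 1 4 5 + triangle 2 3 4 + triangle 2 3 5 + triangle 2 4 5 + triangle 3 4 5)"
    by (simp add: triangle_def)
  also have "\<dots> \<in> covered"
    using bounds(1,2,3) ne
    by (intro covered_diff covered_add covered_three int_span.span_add star_pair_in_low tri) auto
  finally have tri_123: "triangle 1 2 3 \<in> covered" .
  show ?thesis
  proof (cases "{a, b, c} = {1, 2, 3}")
    case False
    then show ?thesis using assms by (intro triangle_in_covered low_free_triples)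
  next
    case True
    have "gram (star {a, b, c}) = triangle a b c" "gram (star {1, 2, 3}) = triangle 1 2 3"
      using assms bounds gram_triple[of a b c] gram_triple[of 1 2 3] by (auto simp: triangle_def le_n_iff le_m_iff)
    then show ?thesis using True tri_123 by simp
  qed
qed

definition cong_covered :: "nat set \<Rightarrow> nat set \<Rightarrow> bool" where
  "cong_covered p q \<longleftrightarrow> star p - star q \<in> covered"

lemma cong_covered_trans [trans]: "cong_covered p q \<Longrightarrow> cong_covered q r \<Longrightarrow> cong_covered p r"
  unfolding cong_covered_def using covered_add by force

text \<open>The four triangles on {a, b, c, d}, with suitable signs, add up to twice the difference of two opposite edges.\<close>

lemma cong_disjoint:
  assumes "{a, b, c, d} \<subseteq> {1..l}" "distinct [a, b, c, d]"
  shows "cong_covered {a, b} {c, d}"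
  unfolding cong_covered_def
proof (rule covered_of_double)
  have "2 * (star {a, b} - star {c, d}) = triangle a b c + triangle a b d - (triangle a c d + triangle b c d)"
    by (simp add: triangle_def)
  also have "\<dots> \<in> covered"
    using assms by (intro covered_diff covered_add triangle_low) auto
  finally show "2 * (star {a, b} - star {c, d}) \<in> covered" .
  show "star {a, b} - star {c, d} \<in> int_span.span low_basis"
    using assms(1) bounds by (intro int_span.span_diff star_pair_in_low) auto
qed

text \<open>At least five points allow a detour through a pair disjoint from both.\<close>

lemma cong_adjacent:
  assumes "{a, b, c} \<subseteq> {1..l}" "distinct [a, b, c]"
  shows "cong_covered {a, b} {a, c}"
proof -
  have "card ({1..l} - {a, b, c}) \<ge> 2"
    using assms bounds(1) by (subst card_Diff_subset) auto
  then obtain D where "D \<subseteq> {1..l} - {a, b, c}" "card D = 2" using obtain_subset_with_card_n by metis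
  then obtain d e where de: "d \<noteq> e" "d \<in> {1..l} - {a, b, c}" "e \<in> {1..l} - {a, b, c}" by (rule pairE) auto
  have "cong_covered {a, b} {d, e}" using assms de by (intro cong_disjoint) auto
  also have "cong_covered {d, e} {a, c}" using assms de by (intro cong_disjoint) auto
  finally show ?thesis .
qed

lemma cong_low:
  assumes "a \<in> {1..l}" "b \<in> {1..l}" "a \<noteq> b"
  shows "cong_covered {a, b} {1, 2}"
proof -
  have adj: "cong_covered {a, b} {a, c}" if "c \<in> {1..l}" "a \<in> {1..l}" "b \<in> {1..l}" "a \<noteq> c" "a \<noteq> b" for a b c
    using that cong_adjacent[of a b c] covered_0 by (cases "b = c") (auto simp: cong_covered_def)
  have two: "cong_covered {a, b} {1, 2}" if "a \<noteq> 1" "a \<in> {1..l}" "b \<in> {1..l}" "a \<noteq> b" for a b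
  proof -
    have "cong_covered {a, b} {a, 1}" using that bounds by (intro adj) auto
    also have "{a, 1} = {1, a}" by auto
    also have "cong_covered {1, a} {1, 2}" using that bounds by (intro adj) auto
    finally show ?thesis .
  qed
  show ?thesis
    using two[of a b] two[of b a] assms by (cases "a = 1") (auto simp: insert_commute)
qed

lemma tied_pairs_no_m: "h \<in> tied_pairs \<Longrightarrow> m \<notin> h"
  using bounds by (auto simp: tied_pairs_def)

lemma tied_pairs_cases: "h \<in> tied_pairs \<Longrightarrow> 2 \<in> h \<or> h = {1, 3} \<or> h = {1, 4}"
  by (auto simp: tied_pairs_def)

lemma tied_pairs_4: "h \<in> tied_pairs \<Longrightarrow> 4 \<in> h \<Longrightarrow> h = {1, 4}"
  by (auto simp: tied_pairs_def)

lemma triple_m_free_triples: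
  assumes "a \<in> {1..l}" "b \<in> {1..l}" "a \<noteq> b" "{a, b} \<notin> tied_pairs"
  shows "{a, b, m} \<in> free_triples"
proof -
  have nm: "m \<noteq> a" "m \<noteq> b" "m \<noteq> 1" "m \<noteq> 2" "m \<noteq> 3" using assms bounds by auto
  have "{a, b, m} \<noteq> insert m h" if "h \<in> tied_pairs" for h
  proof
    assume "{a, b, m} = insert m h"
    then have "{a, b, m} - {m} = insert m h - {m}" by simp
    moreover have "{a, b, m} - {m} = {a, b}" using nm by blast
    moreover have "insert m h - {m} = h" using tied_pairs_no_m[OF that] by blast
    ultimately show False using that assms(4) by simp
  qed
  moreover have "{a, b, m} \<noteq> {1, 2, 3}" using nm by blast
  moreover have "{a, b, m} \<subseteq> {1..m}" using assms bounds by auto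
  moreover have "card {a, b, m} = 3" using assms(3) nm by (simp add: card_insert_if)
  ultimately show ?thesis unfolding free_triples_def by blast
qed

text \<open>Modulo 3 the three edges of the triangle a, b, m sum to 0; if two of them equal the common value
  of all pairs, so does the third.\<close>

lemma cong_m_step:
  assumes a: "a \<in> {1..l}" and b: "b \<in> {1..l}" and ab: "a \<noteq> b" "{a, b} \<notin> tied_pairs"
    and am: "cong_covered {a, m} {1, 2}"
  shows "cong_covered {b, m} {1, 2}"
proof -
  have "{a, b, m} \<in> free_triples" using a b ab by (intro triple_m_free_triples)
  then have Q: "triangle a b m \<in> covered" using a b ab bounds by (intro triangle_in_covered) auto
  have eq: "star {b, m} - star {1, 2} =
      triangle a b m - (star {a, b} - star {1, 2}) - (star {a, m} - star {1, 2}) - 3 * star {1, 2}"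
    by (simp add: triangle_def)
  show ?thesis
    unfolding cong_covered_def eq
    by (rule covered_diff[OF covered_diff[OF covered_diff[OF Q cong_low[OF a b ab(1), unfolded cong_covered_def]]
          am[unfolded cong_covered_def]] covered_three[OF star_pair_in_low]]) (use bounds in auto)
qed

text \<open>The free triples {a, b, m} form the complement of the tied graph. Its odd cycle 3, 4, 5 determines the
  value at {3, m}, and connectedness carries it to all other points.\<close>

lemma cong_m:
  assumes a: "a \<in> {1..l}"
  shows "cong_covered {a, m} {1, 2}"
proof -
  have not_tied: "{a, b} \<notin> tied_pairs" if "a \<in> {3..l}" "b \<in> {3..l}" for a b
  proof
    assume "{a, b} \<in> tied_pairs"
    moreover have "1 \<notin> {a, b}" "2 \<notin> {a, b}" using that by auto
    ultimately show False using tied_pairs_cases by blast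
  qed
  have tri_m: "triangle a b m \<in> covered" if "a \<in> {3..l}" "b \<in> {3..l}" "a \<noteq> b" for a b
    using that bounds not_tied[OF that(1,2)] by (intro triangle_in_covered triple_m_free_triples) auto
  have 3: "cong_covered {3, m} {1, 2}"
    unfolding cong_covered_def
  proof (rule covered_of_double)
    define d where "d a b = star {a, b} - star {1, 2}" for a b
    have d: "d a b \<in> covered" if "a \<in> {1..l}" "b \<in> {1..l}" "a \<noteq> b" for a b
      using cong_low[OF that] by (simp add: cong_covered_def d_def)
    have "2 * (star {3, m} - star {1, 2}) = triangle 3 4 m + triangle 3 5 m - triangle 4 5 m - d 3 4 - d 3 5 + d 4 5 - 3 * star {1, 2}"
      by (simp add: triangle_def d_def)
    also have "\<dots> \<in> covered"
      using bounds by (intro covered_diff covered_add tri_m covered_three star_pair_in_low d) auto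
    finally show "2 * (star {3, m} - star {1, 2}) \<in> covered" .
    show "star {3, m} - star {1, 2} \<in> int_span.span low_basis"
      using bounds by (intro int_span.span_diff star_pair_in_low) auto
  qed
  have ge4: "cong_covered {a, m} {1, 2}" if "a \<in> {4..l}" for a
    by (rule cong_m_step[of 3]) (use that 3 bounds not_tied[of 3 a] in auto)
  have "{5, 1} \<notin> tied_pairs" "{4, 2} \<notin> tied_pairs"
    using tied_pairs_cases[of "{5, 1}"] tied_pairs_4[of "{4, 2}"] by (auto simp: doubleton_eq_iff)
  then have "cong_covered {1, m} {1, 2}" "cong_covered {2, m} {1, 2}"
    using cong_m_step[of 5 1] cong_m_step[of 4 2] ge4 bounds by auto
  then show ?thesis using a 3 ge4[of a] by (cases "a \<in> {1, 2, 3}") auto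
qed

lemma cong_pairs:
  assumes "a \<in> {1..m}" "b \<in> {1..m}" "a \<noteq> b"
  shows "cong_covered {a, b} {1, 2}"
proof -
  have "a \<in> {1..l} \<or> a = m" "b \<in> {1..l} \<or> b = m" using assms by (auto simp: le_m_iff)
  then consider "a \<in> {1..l}" "b \<in> {1..l}" | "a \<in> {1..l}" "b = m" | "b \<in> {1..l}" "a = m"
    using assms(3) by blast
  then show ?thesis
    by cases (use assms(3) cong_low[of a b] cong_m[of a] cong_m[of b] in \<open>simp_all add: insert_commute\<close>)
qed

text \<open>The combinations of pairs behind v and y have total weight 0, hence are sums of differences of pairs.\<close>

lemma target_basis_covered: "target_basis \<subseteq> covered"
proof
  fix g assume "g \<in> target_basis"
  define d where "d a b = star {a, b} - star {1, 2}" for a b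
  have d: "d a b \<in> covered" if "a \<in> {1..m}" "b \<in> {1..m}" "a \<noteq> b" for a b
    using cong_pairs[OF that] by (simp add: cong_covered_def d_def)
  consider a where "g = v a" "a \<in> {2..m}" | p where "g = y p" "p \<in> cycle_pairs"
    using \<open>g \<in> target_basis\<close> by (auto simp: target_basis_def)
  then show "g \<in> covered"
  proof cases
    case 1
    have "g = d 1 a - d 1 3 + d 2 3"
      by (simp add: 1 v_def z_def d_def)
    also have "\<dots> \<in> covered" using 1 bounds by (intro covered_diff covered_add d) auto
    finally show ?thesis .
  next
    case 2
    then have "p \<subseteq> {2..m}" "card p = 2" by (auto simp: cycle_pairs_def)
    then obtain a b where ab: "p = {a, b}" "a \<noteq> b" "a \<in> {2..m}" "b \<in> {2..m}" by (rule pairE)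
    have "g = star {a, b} - star {1, a} - star {1, b} + z" using 2(1) ab(1) y_pair[OF ab(2)] by simp
    also have "\<dots> = d a b - d 1 a - d 1 b + d 1 3 - d 2 3"
      by (simp add: z_def d_def algebra_simps)
    also have "\<dots> \<in> covered" using ab bounds by (intro covered_diff covered_add d) auto
    finally show ?thesis .
  qed
qed

text \<open>The eigenvector belonging to the omitted pair {4, 5}. Together with the target basis it spans, modulo 3 N,
  all that A + 3 attains on the free triples.\<close>

definition \<eta> :: "nat set \<Rightarrow> int" where
  "\<eta> = y {4, 5}"

lemma gram_eta: "gram \<eta> = of_int (int n - 4) * \<eta>"
  using A_y[of "{4, 5}"] bounds by (simp add: gram_def \<eta>_def algebra_simps)

lemma eta_in_low: "\<eta> \<in> int_span.span low_basis"
proof -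
  have "\<eta> = star {4, 5} - star {1, 4} - star {1, 5} + z" by (simp add: \<eta>_def y_pair)
  then show ?thesis
    using bounds by (auto intro!: int_span.span_add int_span.span_diff star_pair_in_low z_in_low)
qed

definition target_mod :: "(nat set \<Rightarrow> int) set" where
  "target_mod = {g. \<exists>\<tau> \<in> int_span.span target_basis. g - \<tau> \<in> low3}"

lemma target_mod_subspace: "int_span.subspace target_mod"
proof (rule int_span.subspaceI)
  show "0 \<in> target_mod" unfolding target_mod_def using low3_sub(4) int_span.span_zero[of target_basis] by force
  fix g h assume "g \<in> target_mod" "h \<in> target_mod"
  then obtain s t where st: "s \<in> int_span.span target_basis" "t \<in> int_span.span target_basis" "g - s \<in> low3" "h - t \<in> low3"
    unfolding target_mod_def by blast
  have "g + h - (s + t) = (g - s) + (h - t)" by simp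
  then have "g + h - (s + t) \<in> low3" using low3_sub(1)[OF st(3,4)] by metis
  then show "g + h \<in> target_mod" unfolding target_mod_def using int_span.span_add[OF st(1,2)] by blast
next
  fix c g assume "g \<in> target_mod"
  then obtain s where s: "s \<in> int_span.span target_basis" "g - s \<in> low3" unfolding target_mod_def by blast
  have "of_int c * g - of_int c * s = of_int c * (g - s)" by (simp add: right_diff_distrib)
  then have "of_int c * g - of_int c * s \<in> low3" using low3_sub(3)[OF s(2)] by metis
  then show "of_int c * g \<in> target_mod" unfolding target_mod_def using int_span.span_scale[OF s(1)] by blast
qed

lemma target_mod_target: "g \<in> int_span.span target_basis \<Longrightarrow> g \<in> target_mod"
  unfolding target_mod_def using low3_sub(4) by force

lemma target_mod_low3: "g \<in> low3 \<Longrightarrow> g \<in> target_mod"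
  unfolding target_mod_def using int_span.span_zero[of target_basis] by force

lemmas target_mod_sub = int_span.subspace_add[OF target_mod_subspace] int_span.subspace_diff[OF target_mod_subspace]
  int_span.subspace_scale[OF target_mod_subspace] int_span.subspace_0[OF target_mod_subspace]

text \<open>The values on free triples leave the span of the target basis only in the direction of \<eta>, and this lemma
  provides an element of N that corrects for it. If n is not 1 modulo 3, the eigenvalue n - 4 of A + 3 at
  \<eta> is invertible modulo 3 and a multiple of \<eta> itself works. If n is 1 modulo 3, the relation \<open>sum_pairs\<close>
  shows that \<eta> is congruent to twice the sum of the stars of the points of {1..m}, on which A + 3 acts as
  multiplication by 2; here m choose 2 is divisible by 3.\<close>

lemma eta_cancel: "\<exists>x \<in> int_span.span low_basis. \<eta> - gram x \<in> target_mod"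
proof -
  interpret gram: Modules.module_hom "\<lambda>c x. of_int c * x" "\<lambda>c x. of_int c * x" gram by (rule gram_linear)
  define k where "k = int n div 3"
  have "int n = 3 * k \<or> int n = 3 * k + 1 \<or> int n = 3 * k + 2" unfolding k_def by presburger
  then consider "int n = 3 * k" | "int n = 3 * k + 1" | "int n = 3 * k + 2" by blast
  then show ?thesis
  proof cases
    case 1
    have "\<eta> - gram (- \<eta>) = 3 * (of_int (k - 1) * \<eta>)"
      unfolding gram.neg gram_eta 1 by (simp add: left_diff_distrib)
    also have "\<dots> \<in> target_mod" by (intro target_mod_low3 low3_I int_span.span_scale eta_in_low)
    finally show ?thesis using eta_in_low by (blast intro: int_span.span_neg)
  next
    case 3
    have "\<eta> - gram \<eta> = 3 * (of_int (1 - k) * \<eta>)"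
      unfolding gram_eta 3 by (simp add: left_diff_distrib)
    also have "\<dots> \<in> target_mod" by (intro target_mod_low3 low3_I int_span.span_scale eta_in_low)
    finally show ?thesis using eta_in_low by blast
  next
    case 2
    define s where "s = (\<Sum>a\<in>{1..m}. star {a})"
    have sN: "s \<in> int_span.span low_basis"
      unfolding s_def using bounds by (intro int_span.span_sum star_in_low) auto
    have "gram s = (\<Sum>a\<in>{1..m}. of_int (2 * int n - 6) * star {a} + 3 * star {})"
      unfolding s_def gram.sum
      by (intro sum.cong refl) (use bounds A_single in \<open>simp add: gram_def left_diff_distrib\<close>)
    also have "\<dots> = of_int (2 * int n - 6) * s + 3 * (of_int (int m) * star {})"
      by (simp add: s_def sum.distrib sum_distrib_left)
    finally have fs: "gram s = of_int (2 * int n - 6) * s + 3 * (of_int (int m) * star {})" .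
    define P where "P = {p. p \<subseteq> {1..m} \<and> card p = 2}"
    have finP: "finite P" unfolding P_def by (rule finite_subset[of _ "Pow {1..m}"]) auto
    have cardP: "card P = m choose 2" unfolding P_def by (simp add: n_subsets)
    have "3 dvd m"
    proof -
      have "int m = 3 * k" using 2 n by simp
      then have "3 dvd int m" by simp
      then show ?thesis by presburger
    qed
    then have "3 dvd 2 * (m choose 2)"
      using times_binomial_minus1_eq[of 2 m] by simp
    then have "3 dvd m choose 2" by presburger
    then obtain c where c: "m choose 2 = 3 * c" by (rule dvdE)
    define \<tau> where "\<tau> = (\<Sum>p\<in>P. star p - z - of_bool (p = {4, 5}) * \<eta>)"
    have \<tau>: "\<tau> \<in> int_span.span target_basis" unfolding \<tau>_def \<eta>_def
      by (intro int_span.span_sum star_pair_mod_target) (auto simp: P_def)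
    have "(\<Sum>p\<in>P. of_bool (p = {4, 5}) * \<eta>) = (\<Sum>p\<in>{{4, 5::nat}}. \<eta>)"
      using bounds finP by (intro sum.mono_neutral_cong_right) (auto simp: P_def)
    then have "\<tau> = (\<Sum>p\<in>P. star p) - of_nat (3 * c) * z - \<eta>"
      unfolding \<tau>_def by (simp add: sum_subtractf cardP c)
    then have eta: "\<eta> = 2 * s - 3 * star {} - 3 * (of_nat c * z) - \<tau>"
      using sum_pairs by (simp add: P_def s_def)
    have "\<eta> - gram s = 3 * (of_int (2 - 2 * k) * s - star {} - of_int (int c) * z - of_int (int m) * star {}) - \<tau>"
      unfolding fs 2 by (subst eta) (simp add: algebra_simps)
    also have "\<dots> \<in> target_mod"
      by (intro target_mod_sub(2) target_mod_low3 low3_I target_mod_target \<tau> int_span.span_diff int_span.span_scale sN star_empty_in_low z_in_low)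
    finally show ?thesis using sN by blast
  qed
qed

definition target_eta :: "(nat set \<Rightarrow> int) set" where
  "target_eta = {g. \<exists>c. g - of_int c * \<eta> \<in> target_mod}"

lemma target_eta_subspace: "int_span.subspace target_eta"
proof (rule int_span.subspaceI)
  show "0 \<in> target_eta" unfolding target_eta_def using target_mod_sub(4) by (auto intro: exI[of _ 0])
  fix g h assume "g \<in> target_eta" "h \<in> target_eta"
  then obtain c d where cd: "g - of_int c * \<eta> \<in> target_mod" "h - of_int d * \<eta> \<in> target_mod" unfolding target_eta_def by blast
  have "g + h - of_int (c + d) * \<eta> = (g - of_int c * \<eta>) + (h - of_int d * \<eta>)"
    by (simp add: algebra_simps)
  then have "g + h - of_int (c + d) * \<eta> \<in> target_mod" using target_mod_sub(1)[OF cd] by metis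
  then show "g + h \<in> target_eta" unfolding target_eta_def by blast
next
  fix b g assume "g \<in> target_eta"
  then obtain c where c: "g - of_int c * \<eta> \<in> target_mod" unfolding target_eta_def by blast
  have "of_int b * g - of_int (b * c) * \<eta> = of_int b * (g - of_int c * \<eta>)"
    by (simp add: algebra_simps)
  then have "of_int b * g - of_int (b * c) * \<eta> \<in> target_mod" using target_mod_sub(3)[OF c] by metis
  then show "of_int b * g \<in> target_eta" unfolding target_eta_def by blast
qed

lemma star_pair_in_target_eta:
  assumes "p \<subseteq> {1..m}" "card p = 2"
  shows "star p - z \<in> target_eta"
proof -
  have "star p - z - of_int (of_bool (p = {4, 5})) * \<eta> \<in> target_mod"
    using target_mod_target[OF star_pair_mod_target[OF assms]] by (simp add: \<eta>_def)
  then show ?thesis unfolding target_eta_def by blast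
qed

text \<open>The three pairs of a triple contribute 3 z, which vanishes modulo 3 N, and at most one \<eta>.\<close>

lemma gram_free_in_target_eta: "x \<in> int_span.span (star ` free_triples) \<Longrightarrow> gram x \<in> target_eta"
proof -
  interpret gram: Modules.module_hom "\<lambda>c x. of_int c * x" "\<lambda>c x. of_int c * x" gram by (rule gram_linear)
  have "gram (star S) \<in> target_eta" if S: "S \<in> free_triples" for S
  proof -
    obtain a b c where abc: "S = {a, b, c}" "a \<noteq> b" "a \<noteq> c" "b \<noteq> c"
      using card_3_distinct[OF free_triples_D(2)[OF S]] by blast
    have sub: "{a, b} \<subseteq> {1..m}" "{a, c} \<subseteq> {1..m}" "{b, c} \<subseteq> {1..m}"
      using free_triples_D(1)[OF S] abc by auto
    have "3 * z - of_int 0 * \<eta> \<in> target_mod" using target_mod_low3[OF low3_I[OF z_in_low]] by simp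
    then have z: "3 * z \<in> target_eta" unfolding target_eta_def by blast
    have "gram (star S) = (star {a, b} - z) + (star {a, c} - z) + (star {b, c} - z) + 3 * z"
      using abc gram_triple[of a b c] free_triples_D(3)[OF S] by simp
    also have "\<dots> \<in> target_eta"
      using abc sub z by (intro int_span.subspace_add[OF target_eta_subspace] star_pair_in_target_eta) auto
    finally show ?thesis .
  qed
  then have "int_span.span (gram ` star ` free_triples) \<subseteq> target_eta"
    by (intro int_span.span_minimal target_eta_subspace) auto
  then show "x \<in> int_span.span (star ` free_triples) \<Longrightarrow> gram x \<in> target_eta" by (auto simp: gram.span_image)
qed

text \<open>Subtracting the right multiple of the corrector from lemma \<open>eta_cancel\<close> removes the component along \<eta>.\<close>

lemma gram_correction: "x \<in> int_span.span (star ` free_triples) \<Longrightarrow> \<exists>\<rho> \<in> int_span.span low_basis. gram (x - \<rho>) \<in> target_mod"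
proof -
  interpret gram: Modules.module_hom "\<lambda>c x. of_int c * x" "\<lambda>c x. of_int c * x" gram by (rule gram_linear)
  assume "x \<in> int_span.span (star ` free_triples)"
  then obtain c where c: "gram x - of_int c * \<eta> \<in> target_mod" using gram_free_in_target_eta unfolding target_eta_def by blast
  obtain e where e: "e \<in> int_span.span low_basis" "\<eta> - gram e \<in> target_mod" using eta_cancel by blast
  have "gram (x - of_int c * e) = (gram x - of_int c * \<eta>) + of_int c * (\<eta> - gram e)"
    by (simp add: gram.diff gram.scale right_diff_distrib)
  also have "\<dots> \<in> target_mod" by (intro target_mod_sub(1,3) c e)
  finally show ?thesis using int_span.span_scale[OF e(1)] by blast
qed

section \<open>Counting and assembly\<close>

lemma two_le_choose: "2 \<le> l choose 2"
proof -
  have "5 choose 2 \<le> l choose 2" using bounds(1) by (rule binomial_right_mono)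
  then show ?thesis by (simp add: choose_two)
qed

lemma finite_cycle_pairs: "finite cycle_pairs" and card_cycle_pairs: "card cycle_pairs = (l choose 2) - 2"
proof -
  have fin: "finite {p. p \<subseteq> {2..m} \<and> card p = 2}" by (rule finite_subset[of _ "Pow {2..m}"]) auto
  then show "finite cycle_pairs" by (simp add: cycle_pairs_def)
  have "{2, 3} \<noteq> {4, 5::nat}" by (auto simp: doubleton_eq_iff)
  then have "card {{2, 3}, {4, 5::nat}} = 2" by simp
  moreover have "{{2, 3}, {4, 5}} \<subseteq> {p. p \<subseteq> {2..m} \<and> card p = 2}" using bounds by auto
  moreover have "card {p. p \<subseteq> {2..m} \<and> card p = 2} = l choose 2"
    using n_subsets[of "{2..m}" 2] m by simp
  ultimately show "card cycle_pairs = (l choose 2) - 2" unfolding cycle_pairs_def by (simp add: card_Diff_subset)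
qed

lemma finite_free_triples: "finite free_triples" and card_free_triples: "card free_triples + m = m choose 3"
proof -
  let ?F = "{S. S \<subseteq> {1..m} \<and> card S = 3}"
  have fin: "finite ?F" by (rule finite_subset[of _ "Pow {1..m}"]) auto
  then show "finite free_triples" by (simp add: free_triples_def)
  have finH: "finite tied_pairs" by (simp add: tied_pairs_def)
  have "inj_on (insert m) tied_pairs"
    by (rule inj_onI) (metis tied_pairs_no_m insert_ident)
  then have 1: "card (insert m ` tied_pairs) = card tied_pairs" by (rule card_image)
  have "card ((\<lambda>a. {2, a}) ` {5..l}) = l - 4"
    by (subst card_image) (auto simp: inj_on_def doubleton_eq_iff)
  moreover have "card {{1, 2}, {1, 3}, {2, 3}, {1, 4::nat}} = 4"
    by (simp add: card_insert_if doubleton_eq_iff)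
  moreover have "{{1, 2}, {1, 3}, {2, 3}, {1, 4}} \<inter> (\<lambda>a. {2, a}) ` {5..l} = {}"
    by (auto simp: doubleton_eq_iff)
  ultimately have "card tied_pairs = l" using bounds unfolding tied_pairs_def by (subst card_Un_disjoint) auto
  moreover have "m \<notin> {1, 2, 3}" using bounds by auto
  then have "{1, 2, 3} \<notin> insert m ` tied_pairs" by blast
  ultimately have cardE: "card (insert {1, 2, 3} (insert m ` tied_pairs)) = m"
    using 1 finH m by (simp add: card_insert_if)
  have sub: "insert {1, 2, 3} (insert m ` tied_pairs) \<subseteq> ?F"
  proof -
    have "insert m h \<in> ?F" if "h \<in> tied_pairs" for h
    proof -
      have h: "h \<subseteq> {1..l}" "card h = 2" using that bounds by (auto simp: tied_pairs_def)
      then have "finite h" "h \<subseteq> {1..m}" using bounds(2) finite_subset by auto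
      then show ?thesis using h(2) tied_pairs_no_m[OF that] bounds by simp
    qed
    moreover have "{1, 2, 3} \<in> ?F" using bounds by simp
    ultimately show ?thesis by blast
  qed
  have "card free_triples = card ?F - m"
    unfolding free_triples_def using card_Diff_subset[OF _ sub] finH cardE by simp
  moreover have "m \<le> card ?F" using card_mono[OF fin sub] cardE by simp
  moreover have "card ?F = m choose 3" by (simp add: n_subsets)
  ultimately show "card free_triples + m = m choose 3" by simp
qed

text \<open>Counting shows that the basis of N and the free triples together have as many elements as there are triples,
  so they are a basis and the target basis stays independent modulo 3 N. The exchange lemma yields ws; the
  other generators are then corrected by elements of N and of the span of ws until A + 3 sends
  them into 3 N.\<close>

lemma adapted_basis:
  assumes vs: "distinct vs" "set vs = johnson_verts n 3"
  obtains ylist ws os where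
    "distinct ylist" "set ylist = cycle_pairs"
    "length ws = length ylist + l"
    "length ws + length os = card free_triples"
    "\<And>i. i < length ylist \<Longrightarrow> gram (ws ! i) - y (ylist ! i) \<in> low3"
    "\<And>j. j < l \<Longrightarrow> gram (ws ! (length ylist + j)) - v (2 + j) \<in> low3"
    "\<And>o'. o' \<in> set os \<Longrightarrow> gram o' \<in> low3"
    "int_span.span (star ` free_triples) \<subseteq> int_span.span (low_basis \<union> set ws \<union> set os)"
proof -
  interpret gram: Modules.module_hom "\<lambda>c x. of_int c * x" "\<lambda>c x. of_int c * x" gram by (rule gram_linear)
  obtain ylist where yl: "set ylist = cycle_pairs" "distinct ylist" using finite_distinct_list[OF finite_cycle_pairs] by blast
  obtain rlist where rl: "set rlist = free_triples" "distinct rlist" using finite_distinct_list[OF finite_free_triples] by blast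
  define bs where "bs = map y ylist @ map v [2..<n]"
  define rest where "rest = map u [2..<n] @ [z, star {1}, star {}] @ map star rlist"
  have len_y: "length ylist = (l choose 2) - 2" using yl card_cycle_pairs by (metis distinct_card)
  have len_r: "length rlist = card free_triples" using rl by (metis distinct_card)
  have interval: "{2..<n} = {2..m}" using n by auto
  have set_bs: "set bs = target_basis" by (simp add: bs_def target_basis_def yl interval)
  have set_full: "set (bs @ rest) = low_basis \<union> star ` free_triples"
    by (auto simp: bs_def rest_def low_basis_def yl rl interval)
  have len_bs: "length bs = length ylist + l" using n m bounds(1) by (simp add: bs_def)
  have len_vs: "length vs = n choose 3"
    using distinct_card[OF vs(1)] vs(2) n_subsets[of "{1..n}" 3] by (simp add: johnson_verts_def)
  note l2 = two_le_choose
  have len_full: "length (bs @ rest) = length vs"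
  proof -
    have c: "n choose 3 = (m choose 3) + (m choose 2)" "m choose 2 = (l choose 2) + l"
      using n m by (simp_all add: numeral_3_eq_3 numeral_2_eq_2)
    have "length (bs @ rest) = (l choose 2) - 2 + l + l + 3 + card free_triples"
      using n m bounds(1) by (simp add: len_bs rest_def len_y len_r)
    then show ?thesis using c l2 card_free_triples m len_vs by linarith
  qed
  have spanning: "\<exists>g \<in> int_span.span (set (bs @ rest)). \<forall>T \<in> set vs. g T = of_bool (T = S)"
    if "S \<in> set vs" for S
  proof -
    have S: "S \<in> johnson_verts n 3" using that vs by simp
    have "star S \<in> int_span.span (set (bs @ rest))"
      unfolding set_full by (rule star_in_low_free_span[OF vertsD(1,3)[OF S]])
    moreover have "star S = (\<lambda>T. of_bool (T = S))" using sum_triples[of "{S}"] S by simp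
    then have "\<forall>T \<in> set vs. star S T = of_bool (T = S)" by simp
    ultimately show ?thesis by blast
  qed
  have indep: "3 dvd c i" if sum: "(\<Sum>i<length bs. of_int (c i) * bs ! i) \<in> low3" and i: "i < length bs" for c i
  proof -
    obtain g where "(\<Sum>i<length bs. of_int (c i) * bs ! i) = 3 * g"
      using sum unfolding low3_def by blast
    then have "(\<Sum>i<length bs. of_int (c i) * bs ! i) = of_int 3 * g" by simp
    then have comb: "(\<Sum>i<length (bs @ rest). of_int (if i < length bs then c i else 0) * (bs @ rest) ! i) = of_int 3 * g"
      using combination_append[of c bs rest] by metis
    have i': "i < length (bs @ rest)" unfolding length_append using i by (rule trans_less_add1)
    have "3 dvd (if i < length bs then c i else 0)"
      by (rule spanning_list_independent_mod[OF vs(1) len_full spanning comb i'])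
    then show ?thesis using i by simp
  qed
  have "\<exists>ws os. length ws = length bs \<and> length ws + length os = length (map star rlist) \<and>
    int_span.span (set (ws @ os)) = int_span.span (set (map star rlist)) \<and>
    (\<forall>i<length bs. gram (ws ! i) - bs ! i \<in> low3)"
  proof (rule exchange_mod_3[OF gram_linear low3_subspace])
    show "3 * gram x \<in> low3" if "x \<in> int_span.span (set (map star rlist))" for x
      using that by (intro low3_I gram_free_in_low) (simp add: rl)
    show "\<exists>x \<in> int_span.span (set (map star rlist)). gram x - b \<in> low3" if "b \<in> set bs" for b
      using that target_basis_covered by (auto simp: set_bs rl covered_def)
  qed (use indep in blast)
  then obtain ws os where ws: "length ws = length bs" "length ws + length os = card free_triples"
    "int_span.span (set (ws @ os)) = int_span.span (star ` free_triples)"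
    "\<And>i. i < length bs \<Longrightarrow> gram (ws ! i) - bs ! i \<in> low3"
    by (auto simp: rl len_r)
  have "\<exists>\<rho> \<in> int_span.span (low_basis \<union> set ws). gram (x - \<rho>) \<in> low3" if x: "x \<in> set os" for x
  proof -
    have "x \<in> int_span.span (star ` free_triples)" using x ws(3) int_span.span_base[of x "set (ws @ os)"] by auto
    then obtain r where r: "r \<in> int_span.span low_basis" "gram (x - r) \<in> target_mod" using gram_correction by blast
    then obtain t where t: "t \<in> int_span.span (set bs)" "gram (x - r) - t \<in> low3"
      unfolding target_mod_def set_bs by blast
    obtain c where c: "t = (\<Sum>i<length bs. of_int (c i) * bs ! i)"
      using span_list_combination[OF t(1)] by blast
    define w where "w = (\<Sum>i<length ws. of_int (c i) * ws ! i)"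
    have "gram w - t = (\<Sum>i<length bs. of_int (c i) * (gram (ws ! i) - bs ! i))"
      unfolding w_def c gram.sum gram.scale ws(1) by (simp add: right_diff_distrib sum_subtractf)
    also have "\<dots> \<in> low3"
      by (intro int_span.subspace_sum[OF low3_subspace] low3_sub(3) ws(4)) simp
    finally have "gram w - t \<in> low3" .
    moreover have "gram (x - (r + w)) = (gram (x - r) - t) - (gram w - t)"
      by (simp add: gram.diff gram.add)
    ultimately have "gram (x - (r + w)) \<in> low3" using low3_sub(2)[OF t(2)] by metis
    moreover have "r + w \<in> int_span.span (low_basis \<union> set ws)"
      using r(1) combination_in_span[of c ws] int_span.span_mono[of low_basis "low_basis \<union> set ws"]
        int_span.span_mono[of "set ws" "low_basis \<union> set ws"]
      by (intro int_span.span_add) (auto simp: w_def)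
    ultimately show ?thesis by blast
  qed
  then obtain \<rho> where \<rho>: "\<And>x. x \<in> set os \<Longrightarrow> \<rho> x \<in> int_span.span (low_basis \<union> set ws)"
    "\<And>x. x \<in> set os \<Longrightarrow> gram (x - \<rho> x) \<in> low3" by metis
  define os' where "os' = map (\<lambda>x. x - \<rho> x) os"
  have "set (ws @ os) \<subseteq> int_span.span (low_basis \<union> set ws \<union> set os')"
  proof
    fix x assume "x \<in> set (ws @ os)"
    then consider "x \<in> set ws" | "x \<in> set os" by auto
    then show "x \<in> int_span.span (low_basis \<union> set ws \<union> set os')"
    proof cases
      case 1
      then show ?thesis by (intro int_span.span_base) auto
    next
      case 2
      have "x - \<rho> x \<in> int_span.span (low_basis \<union> set ws \<union> set os')"
        using 2 by (intro int_span.span_base) (auto simp: os'_def)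
      moreover have "\<rho> x \<in> int_span.span (low_basis \<union> set ws \<union> set os')"
        using \<rho>(1)[OF 2] int_span.span_mono[of "low_basis \<union> set ws" "low_basis \<union> set ws \<union> set os'"] by blast
      ultimately have "(x - \<rho> x) + \<rho> x \<in> int_span.span (low_basis \<union> set ws \<union> set os')"
        by (rule int_span.span_add)
      then show ?thesis by simp
    qed
  qed
  then have final: "int_span.span (star ` free_triples) \<subseteq> int_span.span (low_basis \<union> set ws \<union> set os')"
    unfolding ws(3)[symmetric] by (intro int_span.span_minimal int_span.subspace_span)
  show thesis
  proof (rule that[of ylist ws os'])
    show "distinct ylist" "set ylist = cycle_pairs" using yl by auto
    show "length ws = length ylist + l" using ws(1) len_bs by simp
    show "length ws + length os' = card free_triples" using ws(2) by (simp add: os'_def)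
    show "gram (ws ! i) - y (ylist ! i) \<in> low3" if "i < length ylist" for i
      using ws(4)[of i] that len_bs by (simp add: bs_def nth_append)
    show "gram (ws ! (length ylist + j)) - v (2 + j) \<in> low3" if j: "j < l" for j
    proof -
      have "2 + j < n" using j n m by linarith
      then have "bs ! (length ylist + j) = v (2 + j)" by (simp add: bs_def nth_append)
      then show ?thesis using ws(4)[of "length ylist + j"] j len_bs by simp
    qed
    show "gram o' \<in> low3" if "o' \<in> set os'" for o' using that \<rho>(2) by (auto simp: os'_def)
    show "int_span.span (star ` free_triples) \<subseteq> int_span.span (low_basis \<union> set ws \<union> set os')" by (rule final)
  qed
qed

text \<open>Since 2 n - 9 is odd, the factor 4 of 12 only meets n - 7, which is congruent to n - 3 modulo 4.\<close>

lemma core_gcd: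
  assumes "g = gcd ((2 * int n - 9) * (int n - 7)) 12"
  shows "g dvd 3 * (int n - 3)" "g dvd 3 * (int n - 7)"
proof -
  have g: "g dvd (2 * int n - 9) * (int n - 7)" "g dvd 12" using assms by auto
  have odd: "coprime (2 * int n - 9) 4"
    using coprime_power_right_iff[of "2 * int n - 9" 2 2] by simp
  have "gcd ((2 * int n - 9) * (int n - 7)) 12 dvd 3 * gcd ((2 * int n - 9) * (int n - 7)) 4"
  proof -
    have "gcd ((2 * int n - 9) * (int n - 7)) 12 dvd gcd (3 * ((2 * int n - 9) * (int n - 7))) (3 * 4)"
      by (intro gcd_greatest) (auto intro: dvd_mult)
    then show ?thesis
      using gcd_mult_distrib_int[of 3 "(2 * int n - 9) * (int n - 7)" 4] by simp
  qed
  also have "gcd ((2 * int n - 9) * (int n - 7)) 4 = gcd (int n - 7) 4"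
    using odd by (simp add: gcd_mult_left_left_cancel coprime_commute)
  finally have g3: "g dvd 3 * gcd (int n - 7) 4" using assms by simp
  show "g dvd 3 * (int n - 7)"
    using g3 by (rule dvd_trans) (intro mult_dvd_mono dvd_refl gcd_dvd1)
  have "gcd (int n - 7) 4 dvd (int n - 7) + 4" by (intro dvd_add) auto
  then have "3 * gcd (int n - 7) 4 dvd 3 * (int n - 3)" by (intro mult_dvd_mono) simp_all
  with g3 show "g dvd 3 * (int n - 3)" by (rule dvd_trans)
qed

text \<open>The product (2 n - 9)(n - 7) is 2 n (n - 7) minus three times 3 (n - 7), so it is a combination of two of
  the five numbers; the other divisibilities are given by lemma \<open>core_gcd\<close>.\<close>

lemma gcd_simplified:
  "Gcd {3 * (int n - 3) * (2 * int n - 9), (int n - 7) * (int n - 3) * (2 * int n - 9), 12,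
      2 * int n * (int n - 7), 3 * (int n - 7)} = gcd ((2 * int n - 9) * (int n - 7)) 12"
  (is "Gcd ?S = ?g")
proof (rule associated_eqI)
  note g = core_gcd[OF refl]
  have g1: "?g dvd (2 * int n - 9) * (int n - 7)" "?g dvd 12" by auto
  have "2 * int n * (int n - 7) = (2 * int n - 9) * (int n - 7) + 3 * (3 * (int n - 7))"
    by (simp add: algebra_simps)
  moreover have "?g dvd \<dots>" by (intro dvd_add g1 dvd_mult g)
  ultimately have "?g dvd 2 * int n * (int n - 7)" by simp
  moreover have "?g dvd 3 * (int n - 3) * (2 * int n - 9)" by (intro dvd_mult2 g)
  moreover have "?g dvd (int n - 7) * (int n - 3) * (2 * int n - 9)"
  proof -
    have "(int n - 7) * (int n - 3) * (2 * int n - 9) = (2 * int n - 9) * (int n - 7) * (int n - 3)" by simp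
    then show ?thesis using g1(1) by (metis dvd_mult2)
  qed
  ultimately show "?g dvd Gcd ?S" using g g1 by (intro Gcd_greatest) auto
  have S: "Gcd ?S dvd 2 * int n * (int n - 7)" "Gcd ?S dvd 3 * (int n - 7)" "Gcd ?S dvd 12"
    by (rule Gcd_dvd; blast)+
  have "Gcd ?S dvd 2 * int n * (int n - 7) - 3 * (3 * (int n - 7))"
    by (rule dvd_diff[OF S(1) dvd_mult[OF S(2)]])
  also have "\<dots> = (2 * int n - 9) * (int n - 7)" by (simp add: algebra_simps)
  finally show "Gcd ?S dvd ?g" using S(3) by (rule gcd_greatest)
qed (simp_all only: normalize_Gcd normalize_gcd)

text \<open>The source side of the blocks contains the new generators of R, the target side contains their translates by
  elements of N. Both sides contain the basis of N, so both span everything.\<close>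

lemma diag_block_johnson:
  fixes g :: int
  assumes vs: "distinct vs" "set vs = johnson_verts n 3"
    and g: "g = gcd ((2 * int n - 9) * (int n - 7)) 12"
  shows "\<exists>P Q r. diag_block A P Q
      (replicate_mset ((l choose 2) - 2) (3 * (int n - 7)) +
       replicate_mset l (3 * (2 * int n - 9) * (int n - 7)) +
       replicate_mset r 3 +
       {#3 * (int n - 3) * (int n - 7) * (2 * int n - 9) div g, g#} +
       replicate_mset ((l choose 2) - 2 + 2 * l + 1) 1) \<and>
    (l choose 2) - 2 + l + r = card free_triples \<and>
    (\<forall>S \<in> johnson_verts n 3. star S \<in> int_span.span P \<and> star S \<in> int_span.span Q)"
proof -
  let ?a = "int n - 7"
  obtain ylist ws os where basis:
    "distinct ylist" "set ylist = cycle_pairs"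
    "length ws = length ylist + l" "length ws + length os = card free_triples"
    "\<And>i. i < length ylist \<Longrightarrow> gram (ws ! i) - y (ylist ! i) \<in> low3"
    "\<And>j. j < l \<Longrightarrow> gram (ws ! (length ylist + j)) - v (2 + j) \<in> low3"
    "\<And>o'. o' \<in> set os \<Longrightarrow> gram o' \<in> low3"
    "int_span.span (star ` free_triples) \<subseteq> int_span.span (low_basis \<union> set ws \<union> set os)"
    using adapted_basis[OF vs] by metis
  define k where "k = length ylist"
  have k: "k = (l choose 2) - 2"
    using basis(1,2) card_cycle_pairs unfolding k_def by (metis distinct_card)
  have A_of_f: "A w = b - 3 * (w - \<nu>)" if "gram w - b = 3 * \<nu>" for w b \<nu>
    using that by (simp add: gram_def algebra_simps)
  have "\<forall>i<k. \<exists>\<nu>. \<nu> \<in> int_span.span low_basis \<and> gram (ws ! i) - y (ylist ! i) = 3 * \<nu>"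
    using basis(5) by (auto simp: low3_def k_def)
  then obtain \<nu> where \<nu>: "\<And>i. i < k \<Longrightarrow> \<nu> i \<in> int_span.span low_basis"
      "\<And>i. i < k \<Longrightarrow> A (ws ! i) = y (ylist ! i) - 3 * (ws ! i - \<nu> i)"
    using A_of_f by metis
  have "\<forall>j<l. \<exists>\<mu>. \<mu> \<in> int_span.span low_basis \<and> gram (ws ! (k + j)) - v (2 + j) = 3 * \<mu>"
    using basis(6) by (auto simp: low3_def k_def)
  then obtain \<mu> where \<mu>: "\<And>j. j < l \<Longrightarrow> \<mu> j \<in> int_span.span low_basis"
      "\<And>j. j < l \<Longrightarrow> A (ws ! (k + j)) = v (2 + j) - 3 * (ws ! (k + j) - \<mu> j)"
    using A_of_f by metis
  have "\<forall>j<length os. \<exists>\<kappa>. \<kappa> \<in> int_span.span low_basis \<and> gram (os ! j) - 0 = 3 * \<kappa>"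
  proof (intro allI impI)
    fix j assume "j < length os"
    then have "gram (os ! j) \<in> low3" by (simp add: basis(7))
    then show "\<exists>\<kappa>. \<kappa> \<in> int_span.span low_basis \<and> gram (os ! j) - 0 = 3 * \<kappa>"
      unfolding low3_def diff_0_right by blast
  qed
  then obtain \<kappa> where \<kappa>: "\<And>j. j < length os \<Longrightarrow> \<kappa> j \<in> int_span.span low_basis"
      "\<And>j. j < length os \<Longrightarrow> A (os ! j) = 0 - 3 * (os ! j - \<kappa> j)"
    using A_of_f by (metis (no_types))
  have yl: "ylist ! i \<in> cycle_pairs" if "i < k" for i
    using nth_mem[of i ylist] that unfolding k_def basis(2) by blast
  have vl: "2 + j \<in> {2..m}" if "j < l" for j using that m by simp
  define P where "P = (\<Union>i<k. {ws ! i, y (ylist ! i)}) \<union> (\<Union>j<l. {ws ! (k + j), v (2 + j), u (2 + j)}) \<union>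
    (\<Union>j<length os. {os ! j}) \<union> {z, star {1}, star {}}"
  define Q where "Q = (\<Union>i<k. {ws ! i - \<nu> i, y (ylist ! i)}) \<union> (\<Union>j<l. {ws ! (k + j) - \<mu> j, v (2 + j), u (2 + j)}) \<union>
    (\<Union>j<length os. {\<kappa> j - os ! j}) \<union> {z, star {1}, star {}}"
  define D where "D = (\<Sum>i<k. {#1, 3 * ?a#}) + (\<Sum>j<l. {#1, 1, 3 * (2 * (int n - 5) + 1) * ?a#}) +
    (\<Sum>j<length os. {#3#}) + {#(3 * (int n - 3)) * ?a * (2 * ?a + 5) div g, g, 1#}"
  have "diag_block A P Q D"
    unfolding P_def Q_def D_def
  proof (intro diag_block_Un diag_block_UN)
    fix i assume i: "i < k"
    show "diag_block A {ws ! i, y (ylist ! i)} {ws ! i - \<nu> i, y (ylist ! i)} {#1, 3 * ?a#}"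
      by (rule diag_block_pair[OF A_linear A_y \<nu>(2)[OF i]]) (use yl[OF i] in \<open>auto simp: cycle_pairs_def\<close>)
  next
    fix j assume j: "j < l"
    show "diag_block A {ws ! (k + j), v (2 + j), u (2 + j)} {ws ! (k + j) - \<mu> j, v (2 + j), u (2 + j)}
        {#1, 1, 3 * (2 * (int n - 5) + 1) * ?a#}"
    proof (rule diag_block_triple[OF A_linear _ A_v[OF vl[OF j]] \<mu>(2)[OF j]])
      have "2 * (int n - 5) + 1 = 2 * int n - 9" by simp
      then show "A (u (2 + j)) = of_int (2 * (int n - 5) + 1) * u (2 + j)"
        using A_u[OF vl[OF j]] by (simp only:)
    qed
  next
    fix j assume j: "j < length os"
    have "A (os ! j) = of_int 3 * (\<kappa> j - os ! j)" unfolding \<kappa>(2)[OF j] by (simp add: right_diff_distrib)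
    then show "diag_block A {os ! j} {\<kappa> j - os ! j} {#3#}"
      by (intro diag_block_insert diag_block_empty)
  next
    have a: "2 * ?a + 5 = 2 * int n - 9" by simp
    have "A (star {1}) = of_int (2 * ?a + 5) * star {1} + 3 * star {}"
      unfolding a using bounds by (intro A_single) simp
    moreover have "g = gcd ((2 * ?a + 5) * ?a) 12" unfolding a by (rule g)
    ultimately show "diag_block A {z, star {1}, star {}} {z, star {1}, star {}}
        {#(3 * (int n - 3)) * ?a * (2 * ?a + 5) div g, g, 1#}"
      by (intro diag_block_core[OF A_linear A_z _ A_empty] core_gcd(1)[OF g]) auto
  qed
  moreover have "D = replicate_mset ((l choose 2) - 2) (3 * (int n - 7)) +
       replicate_mset l (3 * (2 * int n - 9) * (int n - 7)) +
       replicate_mset (length os) 3 +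
       {#3 * (int n - 3) * (int n - 7) * (2 * int n - 9) div g, g#} +
       replicate_mset ((l choose 2) - 2 + 2 * l + 1) 1"
  proof -
    have 1: "(\<Sum>i<j. {#1, b#}) = replicate_mset j 1 + replicate_mset j b" for j and b :: int
      by (induction j) auto
    have 2: "(\<Sum>i<j. {#1, 1, b#}) = replicate_mset (2 * j) 1 + replicate_mset j b" for j and b :: int
      by (induction j) auto
    have 3: "(\<Sum>i<j. {#b#}) = replicate_mset j b" for j and b :: int
      by (induction j) auto
    have 4: "replicate_mset (i + j + 1) b = replicate_mset i b + replicate_mset j b + {#b#}" for i j and b :: int
      by (induction i) auto
    have 5: "2 * ?a + 5 = 2 * int n - 9" "2 * (int n - 5) + 1 = 2 * int n - 9" by simp_all
    show ?thesis unfolding D_def 1 2 3 4 5 k by (simp add: add_ac)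
  qed
  moreover have "(l choose 2) - 2 + l + length os = card free_triples" using basis(3,4) k k_def by simp
  moreover have "star S \<in> int_span.span P \<and> star S \<in> int_span.span Q" if S: "S \<in> johnson_verts n 3" for S
  proof -
    have key: "star S \<in> int_span.span B"
      if N: "low_basis \<subseteq> B" and W: "\<And>i. i < k + l \<Longrightarrow> ws ! i \<in> int_span.span B"
        and O: "\<And>j. j < length os \<Longrightarrow> os ! j \<in> int_span.span B" for B
    proof -
      have "set ws \<subseteq> int_span.span B" using W basis(3) by (auto simp: in_set_conv_nth k_def)
      moreover have "set os \<subseteq> int_span.span B" using O by (auto simp: in_set_conv_nth)
      moreover have NB: "low_basis \<subseteq> int_span.span B" using N by (auto intro: int_span.span_base)
      ultimately have "int_span.span (low_basis \<union> set ws \<union> set os) \<subseteq> int_span.span B"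
        by (intro int_span.span_minimal int_span.subspace_span) auto
      then have "star ` free_triples \<subseteq> int_span.span B" using basis(8) int_span.span_base[of _ "star ` free_triples"] by blast
      then have "int_span.span (low_basis \<union> star ` free_triples) \<subseteq> int_span.span B"
        using NB by (intro int_span.span_minimal int_span.subspace_span) auto
      then show ?thesis using star_in_low_free_span[OF vertsD(1,3)[OF S]] by blast
    qed
    have y_index: "\<exists>i<k. p = ylist ! i" if "p \<in> cycle_pairs" for p
      using that basis(2) by (metis in_set_conv_nth k_def)
    have v_index: "\<exists>j<l. a = 2 + j" if "a \<in> {2..m}" for a
      using that m by (intro exI[of _ "a - 2"]) auto
    have NP: "low_basis \<subseteq> P" and NQ: "low_basis \<subseteq> Q"
      unfolding low_basis_def P_def Q_def using y_index v_index by fastforce+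
    have split: "i < k \<or> (\<exists>j<l. i = k + j)" if "i < k + l" for i
      using that by presburger
    have "star S \<in> int_span.span P"
    proof (rule key[OF NP])
      show "ws ! i \<in> int_span.span P" if "i < k + l" for i
        using split[OF that] by (intro int_span.span_base) (auto simp: P_def)
      show "os ! j \<in> int_span.span P" if "j < length os" for j
        using that by (intro int_span.span_base) (auto simp: P_def)
    qed
    moreover have "star S \<in> int_span.span Q"
    proof (rule key[OF NQ])
      have NQ': "g \<in> int_span.span Q" if "g \<in> int_span.span low_basis" for g
        using that int_span.span_mono[OF NQ] by blast
      show "ws ! i \<in> int_span.span Q" if i: "i < k + l" for i
      proof -
        have "\<exists>g \<in> int_span.span low_basis. ws ! i - g \<in> Q"
        proof (cases "i < k")
          case True
          then show ?thesis using \<nu>(1) by (auto simp: Q_def)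
        next
          case False
          then obtain j where "j < l" "i = k + j" using split[OF i] by blast
          then show ?thesis using \<mu>(1) by (auto simp: Q_def)
        qed
        then obtain g where g: "g \<in> int_span.span low_basis" "ws ! i - g \<in> Q" by blast
        have "(ws ! i - g) + g \<in> int_span.span Q"
          by (intro int_span.span_add NQ' g(1) int_span.span_base g(2))
        then show ?thesis by simp
      qed
      show "os ! j \<in> int_span.span Q" if j: "j < length os" for j
      proof -
        have "\<kappa> j - os ! j \<in> Q" using j by (auto simp: Q_def)
        then have "\<kappa> j - (\<kappa> j - os ! j) \<in> int_span.span Q"
          by (intro int_span.span_diff NQ' \<kappa>(1)[OF j] int_span.span_base)
        then show ?thesis by simp
      qed
    qed
    ultimately show ?thesis by simp
  qed
  ultimately show ?thesis by blast
qed

end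

theorem theorem5p8:
  fixes n :: nat and vs :: "nat set list" and X :: int
  assumes n: "n \<ge> 7"
    and vs: "distinct vs" "set vs = johnson_verts n 3"
    and X: "X = Gcd {3 * (int n - 3) * (2 * int n - 9),
                     (int n - 7) * (int n - 3) * (2 * int n - 9),
                     12,
                     2 * int n * (int n - 7),
                     3 * (int n - 7)}"
  shows "\<exists>D. diagonal_form (adjacency_mat (johnson_adj n 3 2) vs) D \<and>
    mset (diag_mat D) =
      replicate_mset ((n choose 2) + 1 - 2 * n) (3 * (int n - 7)) +
      replicate_mset (n - 2) (3 * (2 * int n - 9) * (int n - 7)) +
      replicate_mset ((n choose 3) + n + 1 - 2 * (n choose 2)) 3 +
      {# 3 * (int n - 3) * (int n - 7) * (2 * int n - 9) div X, X #} +
      replicate_mset ((n choose 2) - 2) 1"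
proof -
  define l where "l = n - 2"
  interpret J: johnson_triples n "n - 1" l
    by unfold_locales (use n in \<open>auto simp: l_def\<close>)
  obtain P Q r where block: "diag_block J.A P Q
      (replicate_mset ((l choose 2) - 2) (3 * (int n - 7)) +
       replicate_mset l (3 * (2 * int n - 9) * (int n - 7)) +
       replicate_mset r 3 +
       {#3 * (int n - 3) * (int n - 7) * (2 * int n - 9) div X, X#} +
       replicate_mset ((l choose 2) - 2 + 2 * l + 1) 1)" (is "diag_block _ _ _ ?D")
    and r: "(l choose 2) - 2 + l + r = card J.free_triples"
    and span: "\<And>S. S \<in> johnson_verts n 3 \<Longrightarrow> J.star S \<in> int_span.span P"
      "\<And>S. S \<in> johnson_verts n 3 \<Longrightarrow> J.star S \<in> int_span.span Q"
    using J.diag_block_johnson[OF vs] X J.gcd_simplified by metis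
  have n_l: "n = Suc (Suc l)" "n - 1 = Suc l" using n by (auto simp: l_def)
  have choose: "n choose 2 = (l choose 2) + 2 * l + 1" "n choose 3 = (Suc l choose 3) + (l choose 2) + l"
    unfolding n_l by (simp_all add: numeral_2_eq_2 numeral_3_eq_3)
  note l2 = J.two_le_choose
  have R: "card J.free_triples + Suc l = Suc l choose 3" using J.card_free_triples n_l by simp
  have mult: "(l choose 2) - 2 = (n choose 2) + 1 - 2 * n" "l = n - 2"
    "r = (n choose 3) + n + 1 - 2 * (n choose 2)" "(l choose 2) - 2 + 2 * l + 1 = (n choose 2) - 2"
    using choose l2 r R n_l(1) by linarith+
  have len: "length vs = n choose 3"
    using distinct_card[OF vs(1)] vs(2) n_subsets[of "{1..n}" 3] by (simp add: johnson_verts_def)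
  have "\<exists>D. diagonal_form (adjacency_mat (johnson_adj n 3 2) vs) D \<and> mset (diag_mat D) = ?D"
  proof (rule diagonal_form_of_diag_block[OF vs(1) _ block])
    show "J.A g S = (\<Sum>T \<in> {T \<in> set vs. johnson_adj n 3 2 S T}. g T)" for g S
      unfolding J.A_def vs(2) by (intro sum.cong) (auto simp: johnson_adj_def)
    show "size ?D = length vs"
      using r R choose l2 len by simp
    have "J.star S = (\<lambda>T. of_bool (T = S))" if "S \<in> johnson_verts n 3" for S
      using J.sum_triples[of "{S}"] that by simp
    then show "\<exists>g \<in> int_span.span P. \<forall>T \<in> set vs. g T = of_bool (T = S)"
      "\<exists>g \<in> int_span.span Q. \<forall>T \<in> set vs. g T = of_bool (T = S)" if "S \<in> set vs" for S
      using span[of S] that vs(2) by (metis (no_types))+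
  qed
  then show ?thesis unfolding mult(4) unfolding mult(1,3) mult(2)[symmetric] .
qed

end
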